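(* Let $\Omega$ be a domain in $\mathbb{R}^m$, let $u,v\in W^2(\Omega)$ be real-valued functions and let $\vec F=(F_1,\dots,F_m)\in W^1(\Omega)$ be a vector field. Suppose that for some constant $C>0$, $|\nabla u+\vec F|\ge C$, $|\nabla v+\vec F|\ge C$ and $N_{\vec F}(u)=N_{\vec F}(v)$ in $\Omega$ (a.e.). Suppose either $\Theta_u$ is nonintegrable or $\Theta_v$ is nonintegrable. Then $\nabla u=\nabla v$ in $\Omega$ (a.e.).
   Context: $W^k(\Omega)$ denotes the space of $k$ times weakly differentiable functions on $\Omega$ (locally integrable functions all of whose weak derivatives up to order $k$ exist as locally integrable functions), applied componentwise for vector fields. For a function $w$ with $\nabla w+\vec F\neq 0$ a.e., $N_{\vec F}(w) := \frac{\nabla w+\vec F}{|\nabla w+\vec F|}$. For $w\in W^2(\Omega)$, $\Theta_w := dw+\sum_I F_I\,dx^I$ and $d\Theta_w=\sum_{I,J}\partial_J F_I\,dx^J\wedge dx^I$ (weak derivatives). $\Theta_w$ is called nonintegrable if $\Theta_w\wedge d\Theta_w\neq0$ a.e. in $\Omega$. The integer $m$ need not be even. *)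

theory Defs
  imports "HOL-Analysis.Analysis"
begin

section \<open>Smooth test functions\<close>

definition partial_deriv :: "'n \<Rightarrow> (real^'n \<Rightarrow> real) \<Rightarrow> real^'n \<Rightarrow> real" where
  "partial_deriv i \<phi> x = frechet_derivative \<phi> (at x) (axis i 1)"

text \<open>A list of indices plays the role of a multi-index; its length is the order.
  The order of the entries is irrelevant for smooth functions.\<close>

definition iter_partial :: "'n list \<Rightarrow> (real^'n \<Rightarrow> real) \<Rightarrow> real^'n \<Rightarrow> real" where
  "iter_partial \<alpha> \<phi> = foldr partial_deriv \<alpha> \<phi>"

text \<open>Total differentiability of all iterated partial derivatives makes all of them continuous,
  so this is the class of infinitely differentiable functions.\<close>

definition smooth :: "(real^'n \<Rightarrow> real) \<Rightarrow> bool" where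
  "smooth \<phi> \<longleftrightarrow> (\<forall>\<alpha> x. iter_partial \<alpha> \<phi> differentiable (at x))"

definition test_functions :: "(real^'n) set \<Rightarrow> (real^'n \<Rightarrow> real) set" where
  "test_functions \<Omega> =
     {\<phi>. smooth \<phi> \<and> compact (closure {x. \<phi> x \<noteq> 0}) \<and> closure {x. \<phi> x \<noteq> 0} \<subseteq> \<Omega>}"

section \<open>Weak derivatives and the spaces of weakly differentiable functions\<close>

definition locally_integrable_on :: "(real^'n \<Rightarrow> real) \<Rightarrow> (real^'n) set \<Rightarrow> bool"
    (infixr "locally'_integrable'_on" 46) where
  "f locally_integrable_on \<Omega> \<longleftrightarrow> (\<forall>K. compact K \<and> K \<subseteq> \<Omega> \<longrightarrow> f absolutely_integrable_on K)"

definition has_weak_deriv ::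
    "(real^'n) set \<Rightarrow> 'n list \<Rightarrow> (real^'n \<Rightarrow> real) \<Rightarrow> (real^'n \<Rightarrow> real) \<Rightarrow> bool" where
  "has_weak_deriv \<Omega> \<alpha> f g \<longleftrightarrow>
     f locally_integrable_on \<Omega> \<and> g locally_integrable_on \<Omega> \<and>
     (\<forall>\<phi>\<in>test_functions \<Omega>.
        (LINT x:\<Omega>|lebesgue. f x * iter_partial \<alpha> \<phi> x)
          = (-1) ^ length \<alpha> * (LINT x:\<Omega>|lebesgue. g x * \<phi> x))"

text \<open>On an open set a weak derivative is unique up to null sets; a representative is chosen.
  All statements below about weak derivatives are almost-everywhere statements.\<close>

definition weak_deriv ::
    "(real^'n) set \<Rightarrow> 'n list \<Rightarrow> (real^'n \<Rightarrow> real) \<Rightarrow> real^'n \<Rightarrow> real" where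
  "weak_deriv \<Omega> \<alpha> f = (SOME g. has_weak_deriv \<Omega> \<alpha> f g)"

definition W :: "nat \<Rightarrow> (real^'n) set \<Rightarrow> (real^'n \<Rightarrow> real) set" where
  "W k \<Omega> = {f. f locally_integrable_on \<Omega> \<and> (\<forall>\<alpha>. length \<alpha> \<le> k \<longrightarrow> (\<exists>g. has_weak_deriv \<Omega> \<alpha> f g))}"

definition W_vec :: "nat \<Rightarrow> (real^'n) set \<Rightarrow> (real^'n \<Rightarrow> real^'n) set" where
  "W_vec k \<Omega> = {F. \<forall>I. (\<lambda>x. F x $ I) \<in> W k \<Omega>}"

definition weak_grad :: "(real^'n) set \<Rightarrow> (real^'n \<Rightarrow> real) \<Rightarrow> real^'n \<Rightarrow> real^'n" where
  "weak_grad \<Omega> w x = (\<chi> I. weak_deriv \<Omega> [I] w x)"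

definition N :: "(real^'n) set \<Rightarrow> (real^'n \<Rightarrow> real^'n) \<Rightarrow> (real^'n \<Rightarrow> real) \<Rightarrow> real^'n \<Rightarrow> real^'n" where
  "N \<Omega> F w x = (weak_grad \<Omega> w x + F x) /\<^sub>R norm (weak_grad \<Omega> w x + F x)"

section \<open>Differential forms of low degree\<close>

text \<open>A form of degree k at a point is given by its values on k tangent vectors. The wedge products
  are normalised so that a product of three coordinate forms dx I, dx J, dx K is the
  determinant of the corresponding components.\<close>

type_synonym 'n form1 = "real^'n \<Rightarrow> real"
type_synonym 'n form2 = "real^'n \<Rightarrow> real^'n \<Rightarrow> real"
type_synonym 'n form3 = "real^'n \<Rightarrow> real^'n \<Rightarrow> real^'n \<Rightarrow> real"

definition dx :: "'n::finite \<Rightarrow> 'n form1" where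
  "dx I X = X $ I"

definition wedge11 :: "'n::finite form1 \<Rightarrow> 'n form1 \<Rightarrow> 'n form2" where
  "wedge11 \<theta> \<eta> X Y = \<theta> X * \<eta> Y - \<theta> Y * \<eta> X"

definition wedge12 :: "'n::finite form1 \<Rightarrow> 'n form2 \<Rightarrow> 'n form3" where
  "wedge12 \<theta> \<omega> X Y Z = \<theta> X * \<omega> Y Z - \<theta> Y * \<omega> X Z + \<theta> Z * \<omega> X Y"

definition Theta ::
    "(real^'n) set \<Rightarrow> (real^'n \<Rightarrow> real^'n) \<Rightarrow> (real^'n \<Rightarrow> real) \<Rightarrow> real^'n \<Rightarrow> 'n form1" where
  "Theta \<Omega> F w x X =
     (\<Sum>I\<in>UNIV. weak_deriv \<Omega> [I] w x * dx I X) + (\<Sum>I\<in>UNIV. F x $ I * dx I X)"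

text \<open>The exterior derivative of Theta; it does not involve w, since d(dw) = 0 weakly.\<close>

definition dTheta :: "(real^'n) set \<Rightarrow> (real^'n \<Rightarrow> real^'n) \<Rightarrow> real^'n \<Rightarrow> 'n form2" where
  "dTheta \<Omega> F x X Y =
     (\<Sum>I\<in>UNIV. \<Sum>J\<in>UNIV. weak_deriv \<Omega> [J] (\<lambda>y. F y $ I) x * wedge11 (dx J) (dx I) X Y)"

definition nonintegrable ::
    "(real^'n) set \<Rightarrow> (real^'n \<Rightarrow> real^'n) \<Rightarrow> (real^'n \<Rightarrow> real) \<Rightarrow> bool" where
  "nonintegrable \<Omega> F w \<longleftrightarrow>
     (AE x in lebesgue_on \<Omega>. wedge12 (Theta \<Omega> F w x) (dTheta \<Omega> F x) \<noteq> (\<lambda>X Y Z. 0))"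

end

theory Submission
  imports Defs
begin

text \<open>
  Write \<open>a = \<nabla>u + F\<close> and \<open>b = \<nabla>v + F\<close>. Equality of the normalisations means that b is a positive
  multiple \<open>\<gamma> a\<close> of a, and in particular \<open>a\<^sub>i b\<^sub>j = a\<^sub>j b\<^sub>i\<close> for all i and j. The one-forms \<open>\<Theta>\<^sub>u\<close> and
  \<open>\<Theta>\<^sub>v = \<gamma> \<Theta>\<^sub>u\<close> have the same exterior derivative \<open>d\<Theta>\<close>, because Hessians are symmetric. Formally
  \<open>d\<Theta> = d\<gamma> \<and> \<Theta>\<^sub>u + \<gamma> d\<Theta>\<close>, hence \<open>(1 - \<gamma>) \<Theta>\<^sub>u \<and> d\<Theta> = 0\<close>, and nonintegrability forces \<open>\<gamma> = 1\<close>.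
  Lemma \<open>proportionality_factor_eq_1\<close> is this computation at a single point, with the differentiated
  relation \<open>a\<^sub>i b\<^sub>j = a\<^sub>j b\<^sub>i\<close> in place of the derivative of \<open>\<gamma>\<close>.

  The analytic difficulty is to differentiate \<open>a\<^sub>i b\<^sub>j = a\<^sub>j b\<^sub>i\<close>: the factors are only weakly
  differentiable with locally integrable derivatives, and their product need not be a locally
  integrable function. The way out is pointwise. Lemma \<open>weak_deriv_quotients_tendsto\<close> shows that the
  difference quotients with steps 1/(n+1) of a weakly differentiable function converge almost
  everywhere to its weak derivative; the elementary product rule for difference quotients
  (lemma \<open>product_rule_from_quotients\<close>) then applies at almost every point.

  To obtain the convergence, a smooth bump on a box is integrated over segments of length h parallel
  to an axis (lemma \<open>bump_line_integral\<close>). Used as a test function, the result yields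
  \<open>f (x + h e) - f x = (LINT t:{0..h}|lborel. g (x + t e))\<close> for almost every x
  (lemma \<open>weak_deriv_line_integral\<close>), and the averages over short segments converge by the
  Lebesgue differentiation theorem on lines (lemma \<open>line_averages_tendsto\<close>).
\<close>

section \<open>Smooth test functions\<close>

text \<open>The factor with the power of 1/t keeps the family closed under differentiation up to linear
  combinations; \<open>flat 0\<close> is the usual smooth function vanishing to infinite order at 0.\<close>
definition flat :: "nat \<Rightarrow> real \<Rightarrow> real" where
  "flat k t = (if t > 0 then (1/t)^k * exp (-(1/t)) else 0)"

text \<open>The exponential beats every power of 1/t as t tends to 0 from the right.\<close>
lemma flat_tendsto_0: "(flat k \<longlongrightarrow> 0) (at 0)"
proof -
  have "((\<lambda>t::real. (1/t)^k / exp (1/t)) \<longlongrightarrow> 0) (at_right 0)"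
    using filterlim_compose[OF tendsto_power_div_exp_0 filterlim_inverse_at_top_right]
    by (simp add: divide_inverse)
  then have "(flat k \<longlongrightarrow> 0) (at_right 0)"
    by (rule Lim_transform_eventually)
       (auto simp: eventually_at_filter flat_def exp_minus divide_inverse)
  moreover have "(flat k \<longlongrightarrow> 0) (at_left 0)"
    by (rule tendsto_eventually) (auto simp: eventually_at_filter flat_def)
  ultimately show ?thesis
    by (simp add: filterlim_split_at)
qed

text \<open>Away from 0 this is calculus; at 0 the difference quotient of \<open>flat k\<close> is \<open>flat (Suc k)\<close>,
  which tends to 0.\<close>
lemma flat_has_derivative:
  "(flat k has_real_derivative flat (k+2) t - k * flat (k+1) t) (at t)"
proof -
  consider "t > 0" | "t < 0" | "t = 0" by linarith
  then show ?thesis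
  proof cases
    case 1
    define y where "y = 1/t"
    have dy: "((\<lambda>t. 1/t) has_real_derivative - (y^2)) (at t)"
      using 1 by (auto intro!: derivative_eq_intros simp: y_def power2_eq_square)
    have "((\<lambda>t. (1/t)^k * exp (-(1/t))) has_real_derivative
        real k * (1/t)^(k - Suc 0) * - (y^2) * exp (-(1/t)) + exp (-(1/t)) * - (- (y^2)) * (1/t)^k) (at t)"
      by (intro DERIV_mult DERIV_chain2[OF DERIV_exp] DERIV_minus dy)
         (rule DERIV_cong[OF DERIV_power[OF dy]], simp add: mult_ac)
    moreover have "real k * (1/t)^(k - Suc 0) * - (y^2) * exp (-(1/t)) + exp (-(1/t)) * - (- (y^2)) * (1/t)^k
        = flat (k+2) t - k * flat (k+1) t"
      using 1 by (cases k) (simp_all add: flat_def y_def[symmetric] power2_eq_square algebra_simps)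
    ultimately have "((\<lambda>t. (1/t)^k * exp (-(1/t))) has_real_derivative flat (k+2) t - k * flat (k+1) t) (at t)"
      by simp
    then show ?thesis
      by (rule has_field_derivative_transform_within_open[of _ _ _ "{0<..}"])
         (use 1 in \<open>auto simp: flat_def\<close>)
  next
    case 2
    have "((\<lambda>t. 0) has_real_derivative flat (k+2) t - k * flat (k+1) t) (at t)"
      using 2 by (simp add: flat_def)
    then show ?thesis
      by (rule has_field_derivative_transform_within_open[of _ _ _ "{..<0}"])
         (use 2 in \<open>auto simp: flat_def\<close>)
  next
    case 3
    have "((\<lambda>h. (flat k (0 + h) - flat k 0) / h) \<longlongrightarrow> 0) (at 0)"
      by (rule Lim_transform_eventually[OF flat_tendsto_0[of "Suc k"]])
         (auto simp: eventually_at_filter flat_def divide_simps)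
    then show ?thesis
      using 3 by (simp add: DERIV_def flat_def)
  qed
qed

text \<open>An algebra closed under partial derivatives whose members are differentiable consists of
  smooth functions, so no higher derivative has to be computed. The rule for primitives in one
  coordinate makes room for the integrals of bumps along a coordinate axis.\<close>
inductive_set bump_algebra :: "(real^'n \<Rightarrow> real) set" where
  flat: "(\<lambda>x. flat k (c * x $ i + d)) \<in> bump_algebra"
| const: "(\<lambda>x. c) \<in> bump_algebra"
| add: "f \<in> bump_algebra \<Longrightarrow> g \<in> bump_algebra \<Longrightarrow> (\<lambda>x. f x + g x) \<in> bump_algebra"
| mult: "f \<in> bump_algebra \<Longrightarrow> g \<in> bump_algebra \<Longrightarrow> (\<lambda>x. f x * g x) \<in> bump_algebra"
| primitive: "(\<And>t. (s has_real_derivative s' t) (at t)) \<Longrightarrow>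
    (\<lambda>x. s' (x $ i)) \<in> bump_algebra \<Longrightarrow> (\<lambda>x. s (x $ i)) \<in> bump_algebra"

lemma coordinate_gradient:
  fixes i :: "'n::finite"
  assumes "(s has_real_derivative m) (at (x $ i))"
  shows "((\<lambda>x. s (x $ i)) has_derivative (\<lambda>y. \<Sum>j\<in>UNIV. (if j = i then m else 0) * y $ j)) (at x)"
proof -
  have "((\<lambda>x. s (x $ i)) has_derivative (\<lambda>y. m * y $ i)) (at x)"
    using has_derivative_compose[of "\<lambda>x. x $ i" "\<lambda>y. y $ i" x UNIV s "(*) m"] assms
    by (auto simp: has_field_derivative_def intro!: bounded_linear_imp_has_derivative)
  moreover have "(\<Sum>j\<in>UNIV. (if j = i then m else 0) * y $ j) = m * y $ i" for y :: "real^'n"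
    by (simp add: if_distrib[of "\<lambda>c. c * _"] cong: if_cong)
  ultimately show ?thesis by simp
qed

lemma bump_algebra_gradient:
  fixes f :: "real^'n \<Rightarrow> real"
  assumes "f \<in> bump_algebra"
  shows "\<exists>f'. (\<forall>x. (f has_derivative (\<lambda>y. \<Sum>j\<in>UNIV. f' j x * y $ j)) (at x)) \<and>
              (\<forall>j. f' j \<in> bump_algebra)"
  using assms
proof induction
  case (flat k c i d)
  define m :: "real^'n \<Rightarrow> real" where
    "m = (\<lambda>x. c * (flat (k+2) (c * x $ i + d) + (- real k) * flat (k+1) (c * x $ i + d)))"
  have "((\<lambda>t. flat k (c * t + d)) has_real_derivative m x) (at (x $ i))" for x :: "real^'n"
    unfolding m_def
    by (rule DERIV_cong, rule DERIV_chain2[OF flat_has_derivative])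
       (auto intro!: derivative_eq_intros)
  then have "((\<lambda>x. flat k (c * x $ i + d)) has_derivative
      (\<lambda>y. \<Sum>j\<in>UNIV. (if j = i then m x else 0) * y $ j)) (at x)" for x :: "real^'n"
    by (rule coordinate_gradient)
  moreover have "m \<in> bump_algebra"
    unfolding m_def
    by (intro bump_algebra.mult bump_algebra.add bump_algebra.flat bump_algebra.const)
  then have "(\<lambda>x. if j = i then m x else 0) \<in> bump_algebra" for j
    by (cases "j = i") (auto intro: bump_algebra.const)
  ultimately show ?case
    by (intro exI[of _ "\<lambda>j x. if j = i then m x else 0"]) auto
next
  case (const c)
  show ?case
    by (intro exI[of _ "\<lambda>j x. 0"]) (auto intro: bump_algebra.const)
next
  case (add f g)
  then obtain f' g' where
    d: "\<And>x. (f has_derivative (\<lambda>y. \<Sum>j\<in>UNIV. f' j x * y $ j)) (at x)" "\<And>j. f' j \<in> bump_algebra"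
    "\<And>x. (g has_derivative (\<lambda>y. \<Sum>j\<in>UNIV. g' j x * y $ j)) (at x)" "\<And>j. g' j \<in> bump_algebra"
    by blast
  have "((\<lambda>x. f x + g x) has_derivative (\<lambda>y. \<Sum>j\<in>UNIV. (f' j x + g' j x) * y $ j)) (at x)" for x
    using has_derivative_add[OF d(1) d(3), of x] by (simp add: sum.distrib distrib_right)
  then show ?case
    using d by (intro exI[of _ "\<lambda>j x. f' j x + g' j x"]) (auto intro: bump_algebra.add)
next
  case (mult f g)
  then obtain f' g' where
    d: "\<And>x. (f has_derivative (\<lambda>y. \<Sum>j\<in>UNIV. f' j x * y $ j)) (at x)" "\<And>j. f' j \<in> bump_algebra"
    "\<And>x. (g has_derivative (\<lambda>y. \<Sum>j\<in>UNIV. g' j x * y $ j)) (at x)" "\<And>j. g' j \<in> bump_algebra"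
    by blast
  have "((\<lambda>x. f x * g x) has_derivative (\<lambda>y. \<Sum>j\<in>UNIV. (f x * g' j x + f' j x * g x) * y $ j)) (at x)" for x
  proof -
    have "(\<lambda>y. f x * (\<Sum>j\<in>UNIV. g' j x * y $ j) + (\<Sum>j\<in>UNIV. f' j x * y $ j) * g x)
        = (\<lambda>y. \<Sum>j\<in>UNIV. (f x * g' j x + f' j x * g x) * y $ j)"
      by (rule ext) (simp add: sum.distrib distrib_right sum_distrib_left sum_distrib_right algebra_simps)
    then show ?thesis
      using has_derivative_mult[OF d(1) d(3), of x] by simp
  qed
  then show ?case
    using d mult.hyps
    by (intro exI[of _ "\<lambda>j x. f x * g' j x + f' j x * g x"])
       (auto intro!: bump_algebra.add bump_algebra.mult)
next
  case (primitive s s' i)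
  have "(\<lambda>x. if j = i then s' (x $ i) else 0) \<in> bump_algebra" for j
    using primitive by (cases "j = i") (auto intro: bump_algebra.const)
  then show ?case
    by (intro exI[of _ "\<lambda>j x. if j = i then s' (x $ i) else 0"])
       (auto intro!: coordinate_gradient primitive)
qed

lemma partial_deriv_eq_gradient:
  fixes f :: "real^'n \<Rightarrow> real"
  assumes "\<And>x. (f has_derivative (\<lambda>y. \<Sum>j\<in>UNIV. f' j x * y $ j)) (at x)"
  shows "partial_deriv i f = f' i"
proof
  fix x
  have "frechet_derivative f (at x) = (\<lambda>y. \<Sum>j\<in>UNIV. f' j x * y $ j)"
    using frechet_derivative_at[OF assms] by simp
  then show "partial_deriv i f x = f' i x"
    by (simp add: partial_deriv_def axis_def if_distrib[of "\<lambda>c. _ * c"] cong: if_cong)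
qed

lemma bump_algebra_smooth:
  assumes "f \<in> bump_algebra"
  shows "smooth f"
proof -
  have "iter_partial \<alpha> f \<in> bump_algebra" for \<alpha>
  proof (induction \<alpha>)
    case Nil
    then show ?case using assms by (simp add: iter_partial_def)
  next
    case (Cons i \<alpha>)
    then show ?case
      using bump_algebra_gradient[OF Cons] partial_deriv_eq_gradient[of "iter_partial \<alpha> f" _ i]
      by (force simp: iter_partial_def)
  qed
  then show ?thesis
    unfolding smooth_def using bump_algebra_gradient by (blast intro: differentiableI)
qed

lemma bump_algebra_prod:
  assumes "\<And>i. i \<in> I \<Longrightarrow> f i \<in> bump_algebra"
  shows "(\<lambda>x. \<Prod>i\<in>I. f i x) \<in> bump_algebra"
  using assms
  by (induction I rule: infinite_finite_induct) (auto intro: bump_algebra.mult bump_algebra.const)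

lemma partial_deriv_along_axis:
  assumes "\<phi> differentiable (at (x + t *\<^sub>R axis i 1))"
  shows "((\<lambda>t. \<phi> (x + t *\<^sub>R axis i 1)) has_real_derivative
           partial_deriv i \<phi> (x + t *\<^sub>R axis i 1)) (at t)"
proof -
  let ?D = "frechet_derivative \<phi> (at (x + t *\<^sub>R axis i 1))"
  have "(\<phi> has_derivative ?D) (at (x + t *\<^sub>R axis i 1))"
    using assms by (simp add: frechet_derivative_works[symmetric])
  moreover have "((\<lambda>t. x + t *\<^sub>R axis i 1) has_derivative (\<lambda>t. t *\<^sub>R axis i 1)) (at t)"
    by (auto intro!: derivative_eq_intros)
  ultimately have "((\<lambda>t. \<phi> (x + t *\<^sub>R axis i 1)) has_derivative (\<lambda>t. ?D (t *\<^sub>R axis i 1))) (at t)"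
    using has_derivative_compose by blast
  moreover have "linear ?D"
    using assms linear_frechet_derivative by blast
  ultimately show ?thesis
    by (simp add: has_field_derivative_def partial_deriv_def linear_scale mult_commute_abs)
qed

text \<open>Two applications of the mean value theorem to the mixed second difference.\<close>
lemma mixed_increment:
  fixes \<phi> :: "real^'n \<Rightarrow> real"
  assumes \<phi>: "\<And>x. \<phi> differentiable (at x)" and d\<phi>: "\<And>x. partial_deriv i \<phi> differentiable (at x)"
    and "s > 0"
  shows "\<exists>\<sigma> \<tau>. 0 < \<sigma> \<and> \<sigma> < s \<and> 0 < \<tau> \<and> \<tau> < s \<and>
    \<phi> (x + s *\<^sub>R axis i 1 + s *\<^sub>R axis j 1) - \<phi> (x + s *\<^sub>R axis i 1) - \<phi> (x + s *\<^sub>R axis j 1) + \<phi> x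
      = s^2 * partial_deriv j (partial_deriv i \<phi>) (x + \<sigma> *\<^sub>R axis i 1 + \<tau> *\<^sub>R axis j 1)"
proof -
  define \<rho> where "\<rho> t = \<phi> ((x + s *\<^sub>R axis j 1) + t *\<^sub>R axis i 1) - \<phi> (x + t *\<^sub>R axis i 1)" for t
  define \<rho>' where "\<rho>' t = partial_deriv i \<phi> ((x + s *\<^sub>R axis j 1) + t *\<^sub>R axis i 1)
      - partial_deriv i \<phi> (x + t *\<^sub>R axis i 1)" for t
  have "(\<rho> has_real_derivative \<rho>' t) (at t)" for t
    unfolding \<rho>_def \<rho>'_def by (intro DERIV_diff partial_deriv_along_axis \<phi>)
  then obtain \<sigma> where \<sigma>: "0 < \<sigma>" "\<sigma> < s" "\<rho> s - \<rho> 0 = s * \<rho>' \<sigma>"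
    using MVT2[of 0 s \<rho> \<rho>'] \<open>s > 0\<close> by auto
  define \<eta> where "\<eta> t = partial_deriv i \<phi> ((x + \<sigma> *\<^sub>R axis i 1) + t *\<^sub>R axis j 1)" for t
  define \<eta>' where "\<eta>' t = partial_deriv j (partial_deriv i \<phi>) ((x + \<sigma> *\<^sub>R axis i 1) + t *\<^sub>R axis j 1)" for t
  have "(\<eta> has_real_derivative \<eta>' t) (at t)" for t
    unfolding \<eta>_def \<eta>'_def by (intro partial_deriv_along_axis d\<phi>)
  then obtain \<tau> where \<tau>: "0 < \<tau>" "\<tau> < s" "\<eta> s - \<eta> 0 = s * \<eta>' \<tau>"
    using MVT2[of 0 s \<eta> \<eta>'] \<open>s > 0\<close> by auto
  have "\<rho>' \<sigma> = \<eta> s - \<eta> 0"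
    by (simp add: \<rho>'_def \<eta>_def algebra_simps)
  then have "\<rho> s - \<rho> 0 = s^2 * \<eta>' \<tau>"
    using \<sigma> \<tau> by (simp add: power2_eq_square)
  then show ?thesis
    using \<sigma> \<tau> by (intro exI[of _ \<sigma>] exI[of _ \<tau>]) (simp add: \<rho>_def \<eta>'_def algebra_simps)
qed

text \<open>The second difference over a small square is symmetric in the two directions and close to
  either mixed derivative, which is the classical proof of the symmetry of second derivatives.\<close>
lemma partial_deriv_commute:
  fixes \<phi> :: "real^'n \<Rightarrow> real"
  assumes "\<And>x. \<phi> differentiable (at x)"
    and "\<And>i x. partial_deriv i \<phi> differentiable (at x)"
    and cont: "\<And>i j x. isCont (partial_deriv j (partial_deriv i \<phi>)) x"
  shows "partial_deriv i (partial_deriv j \<phi>) = partial_deriv j (partial_deriv i \<phi>)"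
proof
  fix x :: "real^'n"
  define g where "g i j = partial_deriv j (partial_deriv i \<phi>)" for i j
  define z where "z \<sigma> \<tau> = x + \<sigma> *\<^sub>R axis i 1 + \<tau> *\<^sub>R axis j 1" for \<sigma> \<tau> :: real
  have "\<bar>g j i x - g i j x\<bar> \<le> e" if "e > 0" for e
  proof -
    have "e/2 > 0" using that by simp
    have near: "\<exists>d>0. \<forall>y. dist y x < d \<longrightarrow> \<bar>g i j y - g i j x\<bar> < e/2" for i j
      using cont[where i=i and j=j and x=x] \<open>e/2 > 0\<close>
      unfolding continuous_at_eps_delta g_def dist_real_def by blast
    obtain d where d: "d > 0" "\<And>y. dist y x < d \<Longrightarrow> \<bar>g i j y - g i j x\<bar> < e/2"
      using near[of i j] by blast
    obtain d' where d': "d' > 0" "\<And>y. dist y x < d' \<Longrightarrow> \<bar>g j i y - g j i x\<bar> < e/2"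
      using near[of j i] by blast
    define s where "s = min d d' / 3"
    have s: "s > 0" "2 * s < d" "2 * s < d'"
      using d d' by (auto simp: s_def min_def)
    have close: "dist (z \<sigma> \<tau>) x < 2 * s" if "0 < \<sigma>" "\<sigma> < s" "0 < \<tau>" "\<tau> < s" for \<sigma> \<tau>
    proof -
      have "dist (z \<sigma> \<tau>) x \<le> norm (\<sigma> *\<^sub>R axis i 1 :: real^'n) + norm (\<tau> *\<^sub>R axis j 1 :: real^'n)"
        unfolding z_def dist_norm by (metis add.assoc add_diff_cancel_left' norm_triangle_ineq)
      then show ?thesis using that by simp
    qed
    obtain \<sigma> \<tau> where 1: "0 < \<sigma>" "\<sigma> < s" "0 < \<tau>" "\<tau> < s"
      "\<phi> (x + s *\<^sub>R axis i 1 + s *\<^sub>R axis j 1) - \<phi> (x + s *\<^sub>R axis i 1) - \<phi> (x + s *\<^sub>R axis j 1) + \<phi> x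
        = s^2 * g i j (z \<sigma> \<tau>)"
      using mixed_increment[where \<phi>=\<phi> and i=i and j=j and x=x and s=s] assms s unfolding g_def z_def by blast
    obtain \<tau>' \<sigma>' where 2: "0 < \<tau>'" "\<tau>' < s" "0 < \<sigma>'" "\<sigma>' < s"
      "\<phi> (x + s *\<^sub>R axis j 1 + s *\<^sub>R axis i 1) - \<phi> (x + s *\<^sub>R axis j 1) - \<phi> (x + s *\<^sub>R axis i 1) + \<phi> x
        = s^2 * g j i (x + \<tau>' *\<^sub>R axis j 1 + \<sigma>' *\<^sub>R axis i 1)"
      using mixed_increment[where \<phi>=\<phi> and i=j and j=i and x=x and s=s] assms s unfolding g_def by blast
    have "x + \<tau>' *\<^sub>R axis j 1 + \<sigma>' *\<^sub>R axis i 1 = z \<sigma>' \<tau>'"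
      by (simp add: z_def algebra_simps)
    with 1(5) 2(5) have "s^2 * g i j (z \<sigma> \<tau>) = s^2 * g j i (z \<sigma>' \<tau>')"
      by (simp add: algebra_simps)
    then have "g i j (z \<sigma> \<tau>) = g j i (z \<sigma>' \<tau>')"
      using s by simp
    moreover have "\<bar>g i j (z \<sigma> \<tau>) - g i j x\<bar> < e/2"
      using d(2) close[of \<sigma> \<tau>] 1 s by force
    moreover have "\<bar>g j i (z \<sigma>' \<tau>') - g j i x\<bar> < e/2"
      using d'(2) close[of \<sigma>' \<tau>'] 2 s by force
    ultimately show ?thesis by argo
  qed
  then have "\<bar>g j i x - g i j x\<bar> \<le> 0"
    by (rule field_le_epsilon) auto
  then show "partial_deriv i (partial_deriv j \<phi>) x = partial_deriv j (partial_deriv i \<phi>) x"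
    by (simp add: g_def)
qed

lemma smooth_partial_deriv:
  assumes "smooth \<phi>"
  shows "smooth (partial_deriv i \<phi>)"
  unfolding smooth_def
proof (intro allI)
  fix \<alpha> x
  have "iter_partial (\<alpha> @ [i]) \<phi> differentiable (at x)"
    using assms by (simp add: smooth_def)
  then show "iter_partial \<alpha> (partial_deriv i \<phi>) differentiable (at x)"
    by (simp add: iter_partial_def)
qed

lemma smooth_differentiable:
  assumes "smooth \<phi>"
  shows "\<phi> differentiable (at x)"
  using assms[unfolded smooth_def, rule_format, of "[]"] by (simp add: iter_partial_def)

lemma smooth_partial_deriv_commute:
  assumes "smooth \<phi>"
  shows "partial_deriv i (partial_deriv j \<phi>) = partial_deriv j (partial_deriv i \<phi>)"
  by (intro partial_deriv_commute smooth_differentiable smooth_partial_deriv assms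
        differentiable_imp_continuous_within)

text \<open>Outside the closed support the function vanishes locally, so differentiation does not enlarge
  the support.\<close>
lemma test_function_partial_deriv:
  assumes "\<phi> \<in> test_functions \<Omega>"
  shows "partial_deriv i \<phi> \<in> test_functions \<Omega>"
proof -
  let ?S = "closure {x. \<phi> x \<noteq> 0}"
  have \<phi>: "smooth \<phi>" "compact ?S" "?S \<subseteq> \<Omega>"
    using assms by (auto simp: test_functions_def)
  have "partial_deriv i \<phi> x = 0" if "x \<notin> ?S" for x
  proof -
    have "((\<lambda>y. 0) has_derivative (\<lambda>y. 0)) (at x)"
      by simp
    then have "(\<phi> has_derivative (\<lambda>y. 0)) (at x)"
      by (rule has_derivative_transform_within_open[of _ _ _ _ "- ?S"])
         (use that closure_subset[of "{x. \<phi> x \<noteq> 0}"] in auto)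
    then show ?thesis
      using frechet_derivative_at[of \<phi> "\<lambda>y. 0" x] by (metis partial_deriv_def)
  qed
  then have "{x. partial_deriv i \<phi> x \<noteq> 0} \<subseteq> ?S"
    by auto
  then have "closure {x. partial_deriv i \<phi> x \<noteq> 0} \<subseteq> ?S"
    by (simp add: closure_minimal)
  moreover from this have "compact (closure {x. partial_deriv i \<phi> x \<noteq> 0})"
    using bounded_subset[OF compact_imp_bounded[OF \<phi>(2)]] by (simp add: compact_eq_bounded_closed del: compact_closure)
  ultimately show ?thesis
    using \<phi> smooth_partial_deriv[OF \<phi>(1)] by (auto simp: test_functions_def)
qed

section \<open>Bumps on boxes and their line integrals\<close>

text \<open>The parameter c is a steepness: as it grows, the bumps tend to the indicator of the
  open box while staying below it. Thus bumps detect integrals over boxes.\<close>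
definition bump :: "real \<Rightarrow> real^'n \<Rightarrow> real^'n \<Rightarrow> real^'n \<Rightarrow> real" where
  "bump c a b x = (\<Prod>i\<in>UNIV. flat 0 (c * (x $ i - a $ i)) * flat 0 (c * (b $ i - x $ i)))"

lemma flat_0_bounds: "0 \<le> flat 0 t" "flat 0 t \<le> 1"
  by (auto simp: flat_def)

lemma flat_affine_in_bump_algebra:
  "(\<lambda>x. flat k (c * (x $ i - d))) \<in> bump_algebra" "(\<lambda>x. flat k (c * (d - x $ i))) \<in> bump_algebra"
  using bump_algebra.flat[of k c i "- c * d"] bump_algebra.flat[of k "- c" i "c * d"]
  by (simp_all add: algebra_simps)

lemma continuous_on_flat:
  assumes "continuous_on S f"
  shows "continuous_on S (\<lambda>x. flat k (f x))"
proof -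
  have "continuous_on UNIV (flat k)"
    by (intro continuous_at_imp_continuous_on ballI DERIV_isCont[OF flat_has_derivative])
  then show ?thesis
    using assms by (rule continuous_on_compose2) auto
qed

lemma continuous_on_bump: "continuous_on UNIV (bump c a b)"
  unfolding bump_def by (intro continuous_on_prod continuous_on_mult continuous_on_flat continuous_on_diff
      continuous_on_const continuous_on_component continuous_on_id)

lemma bump_bounds:
  assumes "c > 0"
  shows "0 \<le> bump c a b x" "bump c a b x \<le> indicator (box a b) x"
proof -
  show "0 \<le> bump c a b x"
    unfolding bump_def by (intro prod_nonneg mult_nonneg_nonneg ballI flat_0_bounds)
  show "bump c a b x \<le> indicator (box a b) x"
  proof (cases "x \<in> box a b")
    case True
    have "bump c a b x \<le> 1"
      unfolding bump_def
      by (intro prod_le_1 conjI mult_nonneg_nonneg mult_le_one flat_0_bounds)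
    then show ?thesis using True by simp
  next
    case False
    then obtain i where "x $ i \<le> a $ i \<or> b $ i \<le> x $ i"
      by (auto simp: mem_box_cart not_less)
    then have "flat 0 (c * (x $ i - a $ i)) * flat 0 (c * (b $ i - x $ i)) = 0"
      using assms by (auto simp: flat_def zero_less_mult_iff)
    then have "bump c a b x = 0"
      unfolding bump_def by (intro prod_zero) auto
    then show ?thesis using False by simp
  qed
qed

lemma bump_tendsto_indicator:
  "(\<lambda>n. bump (real (Suc n)) a b x) \<longlonglongrightarrow> indicator (box a b) x"
proof -
  have lim: "(\<lambda>n. flat 0 (real (Suc n) * t)) \<longlonglongrightarrow> of_bool (t > 0)" for t
  proof (cases "t > 0")
    case True
    have "(\<lambda>n. exp (- (inverse (real (Suc n)) * (1/t)))) \<longlonglongrightarrow> exp (- (0 * (1/t)))"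
      by (intro tendsto_intros LIMSEQ_inverse_real_of_nat)
    then show ?thesis
      using True by (simp add: flat_def divide_simps zero_less_mult_iff)
  next
    case False
    then have "flat 0 (real (Suc n) * t) = 0" for n
      by (simp add: flat_def zero_less_mult_iff)
    then show ?thesis using False by simp
  qed
  have "(\<lambda>n. bump (real (Suc n)) a b x) \<longlonglongrightarrow>
      (\<Prod>i\<in>UNIV. of_bool (x $ i - a $ i > 0) * of_bool (b $ i - x $ i > 0))"
    unfolding bump_def by (intro tendsto_prod tendsto_mult lim)
  also have "(\<Prod>i\<in>UNIV. of_bool (x $ i - a $ i > 0) * of_bool (b $ i - x $ i > 0)) = (indicator (box a b) x :: real)"
  proof (cases "x \<in> box a b")
    case True
    then show ?thesis by (simp add: mem_box_cart)
  next
    case False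
    then obtain i where "x $ i \<le> a $ i \<or> b $ i \<le> x $ i"
      by (auto simp: mem_box_cart not_less)
    then have "(\<Prod>i\<in>UNIV. of_bool (x $ i - a $ i > 0) * of_bool (b $ i - x $ i > 0)) = (0::real)"
      by (intro prod_zero bexI[of _ i]) auto
    then show ?thesis using False by simp
  qed
  finally show ?thesis .
qed

text \<open>The integral of a bump over segments in direction k is again a test function, and its partial
  derivative in that direction is a difference of two translates of the bump. Testing a weak
  derivative with it gives an integrated fundamental theorem of calculus.\<close>
lemma bump_line_integral:
  fixes a b :: "real^'n"
  assumes "h > 0"
  obtains \<phi> where "\<phi> \<in> bump_algebra"
    and "\<And>x. partial_deriv k \<phi> x = bump c a b x - bump c a b (x - h *\<^sub>R axis k 1)"
    and "\<And>x. \<phi> x = (LINT t:{0..h}|lborel. bump c a b (x - t *\<^sub>R axis k 1))"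
proof -
  \<comment> \<open>The k-th factor is integrated through a primitive S; the remaining factors P do not vary
    along the axis.\<close>
  define \<sigma> where "\<sigma> t = flat 0 (c * (t - a $ k)) * flat 0 (c * (b $ k - t))" for t
  define P where "P x = (\<Prod>i\<in>-{k}. flat 0 (c * (x $ i - a $ i)) * flat 0 (c * (b $ i - x $ i)))" for x :: "real^'n"
  have cont: "continuous_on UNIV \<sigma>"
    unfolding \<sigma>_def by (intro continuous_on_mult continuous_on_flat continuous_on_diff
        continuous_on_const continuous_on_id)
  then have "isCont \<sigma> t" for t
    by (simp add: continuous_on_eq_continuous_at)
  then obtain S where S: "\<And>t. (S has_real_derivative \<sigma> t) (at t)"
    using einterval_antiderivative[of "-\<infinity>" "\<infinity>" \<sigma>]
    by (auto simp: has_real_derivative_iff_has_vector_derivative)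
  have P_shift: "P (x + t *\<^sub>R axis k 1) = P x" for x t
    unfolding P_def by (intro prod.cong) (auto simp: axis_def)
  have bump_eq: "bump c a b x = \<sigma> (x $ k) * P x" for x
    unfolding bump_def \<sigma>_def P_def by (subst prod.remove[of _ k]) (auto simp: Compl_eq_Diff_UNIV)
  have bump_shift: "bump c a b (x - t *\<^sub>R axis k 1) = \<sigma> (x $ k - t) * P x" for x t
    using P_shift[of x "- t"] by (simp add: bump_eq axis_def)
  define \<phi> where "\<phi> x = (S (x $ k) - S (x $ k - h)) * P x" for x
  have "P \<in> bump_algebra"
    unfolding P_def by (intro bump_algebra_prod bump_algebra.mult flat_affine_in_bump_algebra)
  moreover have "(\<lambda>x. S (x $ k) - S (x $ k - h)) \<in> bump_algebra"
  proof (rule bump_algebra.primitive)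
    show "((\<lambda>t. S t - S (t - h)) has_real_derivative \<sigma> t + (-1) * \<sigma> (t - h)) (at t)" for t
      by (auto intro!: derivative_eq_intros DERIV_chain2[OF S] S)
    have "(\<lambda>x::real^'n. flat 0 (c * (x $ k - (a $ k + h))) * flat 0 (c * ((b $ k + h) - x $ k))) \<in> bump_algebra"
      by (intro bump_algebra.mult flat_affine_in_bump_algebra)
    moreover have "(\<lambda>x::real^'n. flat 0 (c * (x $ k - (a $ k + h))) * flat 0 (c * ((b $ k + h) - x $ k)))
        = (\<lambda>x. \<sigma> (x $ k - h))"
      by (simp add: \<sigma>_def algebra_simps)
    ultimately have "(\<lambda>x::real^'n. \<sigma> (x $ k - h)) \<in> bump_algebra" by simp
    moreover have "(\<lambda>x::real^'n. \<sigma> (x $ k)) \<in> bump_algebra"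
      unfolding \<sigma>_def by (intro bump_algebra.mult flat_affine_in_bump_algebra)
    ultimately show "(\<lambda>x::real^'n. \<sigma> (x $ k) + (-1) * \<sigma> (x $ k - h)) \<in> bump_algebra"
      by (intro bump_algebra.add bump_algebra.mult bump_algebra.const)
  qed
  ultimately have \<phi>: "\<phi> \<in> bump_algebra"
    unfolding \<phi>_def by (intro bump_algebra.mult)
  show thesis
  proof
    show "\<phi> \<in> bump_algebra" by (fact \<phi>)
    show "partial_deriv k \<phi> x = bump c a b x - bump c a b (x - h *\<^sub>R axis k 1)" for x
    proof -
      have "((\<lambda>t. \<phi> (x + t *\<^sub>R axis k 1)) has_real_derivative partial_deriv k \<phi> x) (at 0)"
        using partial_deriv_along_axis[OF smooth_differentiable[OF bump_algebra_smooth[OF \<phi>]], where x=x and t=0 and i=k] by simp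
      moreover have "((\<lambda>t. (S (x $ k + t) - S (x $ k + t - h)) * P x) has_real_derivative
          (\<sigma> (x $ k) - \<sigma> (x $ k - h)) * P x) (at 0)"
        by (auto intro!: derivative_eq_intros DERIV_chain2[OF S])
      moreover have "\<phi> (x + t *\<^sub>R axis k 1) = (S (x $ k + t) - S (x $ k + t - h)) * P x" for t
        unfolding \<phi>_def P_shift by (simp add: axis_def)
      ultimately have "partial_deriv k \<phi> x = (\<sigma> (x $ k) - \<sigma> (x $ k - h)) * P x"
        by (auto intro: DERIV_unique)
      then show ?thesis
        unfolding bump_shift by (simp add: bump_eq algebra_simps)
    qed
    show "\<phi> x = (LINT t:{0..h}|lborel. bump c a b (x - t *\<^sub>R axis k 1))" for x
    proof -
      have "(LINT t|lborel. indicator {0..h} t *\<^sub>R (\<sigma> (x $ k - t) * P x))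
          = - S (x $ k - h) * P x - - S (x $ k - 0) * P x"
      proof (rule integral_FTC_atLeastAtMost)
        show "((\<lambda>t. - S (x $ k - t) * P x) has_vector_derivative \<sigma> (x $ k - t) * P x) (at t within {0..h})" for t
          unfolding has_real_derivative_iff_has_vector_derivative[symmetric]
          by (rule has_field_derivative_at_within)
             (auto intro!: derivative_eq_intros DERIV_chain2[OF S])
        show "continuous_on {0..h} (\<lambda>t. \<sigma> (x $ k - t) * P x)"
          by (intro continuous_on_mult continuous_on_compose2[OF cont] continuous_on_diff
                continuous_on_id continuous_on_const) auto
      qed (use assms in simp)
      then show ?thesis
        by (simp add: set_lebesgue_integral_def bump_shift \<phi>_def algebra_simps)
    qed
  qed
qed

section \<open>Line integrals and Lebesgue differentiation\<close>

lemma
  fixes f :: "'a::euclidean_space \<Rightarrow> real"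
  assumes [measurable]: "f \<in> borel_measurable borel"
  shows lborel_integrable_translation: "integrable lborel (\<lambda>x. f (x + c)) \<longleftrightarrow> integrable lborel f"
    and lborel_integral_translation: "(\<integral>x. f (x + c) \<partial>lborel) = integral\<^sup>L lborel f"
proof -
  have "integrable (distr lborel borel ((+) c)) f \<longleftrightarrow> integrable lborel (\<lambda>x. f (c + x))"
    by (rule integrable_distr_eq) auto
  then show "integrable lborel (\<lambda>x. f (x + c)) \<longleftrightarrow> integrable lborel f"
    by (simp add: lborel_distr_plus add.commute)
  have "integral\<^sup>L (distr lborel borel ((+) c)) f = (\<integral>x. f (c + x) \<partial>lborel)"
    by (rule integral_distr) auto
  then show "(\<integral>x. f (x + c) \<partial>lborel) = integral\<^sup>L lborel f"
    by (simp add: lborel_distr_plus add.commute)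
qed

text \<open>The common value m of the integrals bounds the norm of the slices uniformly in t, so the double
  integral over a strip of finite width converges.\<close>
lemma integrable_strip:
  fixes H :: "real \<Rightarrow> 'a::euclidean_space \<Rightarrow> real"
  assumes [measurable]: "case_prod H \<in> borel_measurable (lborel \<Otimes>\<^sub>M lborel)"
    and bound: "\<And>t x. \<bar>H t x\<bar> \<le> indicator {0..h} t * G t x"
    and G: "\<And>t. integrable lborel (G t)" "\<And>t. integral\<^sup>L lborel (G t) = m"
  shows "integrable (lborel \<Otimes>\<^sub>M lborel) (case_prod H)"
proof (rule lborel_pair.Fubini_integrable)
  have int: "integrable lborel (\<lambda>x. H t x)" for t
  proof (rule Bochner_Integration.integrable_bound)
    show "integrable lborel (\<lambda>x. indicator {0..h} t * G t x)"
      by (intro integrable_mult_right G)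
    show "AE x in lborel. norm (H t x) \<le> norm (indicator {0..h} t * G t x)"
      using bound[of t] by (auto intro!: AE_I2 order_trans[OF _ abs_ge_self])
  qed measurable
  then show "AE t in lborel. integrable lborel (\<lambda>x. case_prod H (t, x))"
    by simp
  show "integrable lborel (\<lambda>t. \<integral>x. norm (case_prod H (t, x)) \<partial>lborel)"
  proof (rule Bochner_Integration.integrable_bound)
    show "integrable lborel (\<lambda>t. indicator {0..h} t * \<bar>m\<bar>)"
      by (intro integrable_mult_left) (auto simp: emeasure_lborel_Icc_eq)
    show "AE t in lborel. norm (\<integral>x. norm (case_prod H (t, x)) \<partial>lborel) \<le> norm (indicator {0..h} t * \<bar>m\<bar>)"
    proof (rule AE_I2)
      fix t
      have "(\<integral>x. norm (H t x) \<partial>lborel) \<le> (\<integral>x. indicator {0..h} t * G t x \<partial>lborel)"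
        using int G(1) bound by (intro integral_mono integrable_norm integrable_mult_right) auto
      also have "\<dots> \<le> indicator {0..h} t * \<bar>m\<bar>"
        by (simp add: G(2) mult_left_mono)
      finally show "norm (\<integral>x. norm (case_prod H (t, x)) \<partial>lborel) \<le> norm (indicator {0..h} t * \<bar>m\<bar>)"
        by (simp add: integral_nonneg_AE)
    qed
  qed measurable
qed measurable

text \<open>Integration along a segment is self-adjoint up to reversing the segment, by Fubini and
  invariance of Lebesgue measure under translation.\<close>
lemma
  fixes g \<psi> :: "'a::euclidean_space \<Rightarrow> real"
  assumes g: "integrable lborel g" and [measurable]: "\<psi> \<in> borel_measurable borel"
    and \<psi>: "\<And>x. \<bar>\<psi> x\<bar> \<le> 1"
  shows integrable_line_integral:
      "integrable lborel (\<lambda>x. (LINT t:{0..h}|lborel. g (x + t *\<^sub>R e)) * \<psi> x)"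
    and integral_line_integral:
      "(\<integral>x. (LINT t:{0..h}|lborel. g (x + t *\<^sub>R e)) * \<psi> x \<partial>lborel)
        = (\<integral>x. g x * (LINT t:{0..h}|lborel. \<psi> (x - t *\<^sub>R e)) \<partial>lborel)"
proof -
  have [measurable]: "g \<in> borel_measurable borel"
    using g by (simp add: integrable_iff_bounded)
  define F where "F t x = indicator {0..h} t * (g (x + t *\<^sub>R e) * \<psi> x)" for t x
  define H where "H t x = indicator {0..h} t * (g x * \<psi> (x - t *\<^sub>R e))" for t x
  have F: "integrable (lborel \<Otimes>\<^sub>M lborel) (case_prod F)"
  proof (rule integrable_strip)
    show "case_prod F \<in> borel_measurable (lborel \<Otimes>\<^sub>M lborel)"
      unfolding F_def by measurable
    show "\<bar>F t x\<bar> \<le> indicator {0..h} t * \<bar>g (x + t *\<^sub>R e)\<bar>" for t x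
      using \<psi>[of x] by (auto simp: F_def abs_mult indicator_def intro: mult_left_le)
    show "integrable lborel (\<lambda>x. \<bar>g (x + t *\<^sub>R e)\<bar>)" for t
      using g by (intro integrable_abs) (simp add: lborel_integrable_translation)
    show "(\<integral>x. \<bar>g (x + t *\<^sub>R e)\<bar> \<partial>lborel) = (\<integral>x. \<bar>g x\<bar> \<partial>lborel)" for t
      by (rule lborel_integral_translation) measurable
  qed
  have H: "integrable (lborel \<Otimes>\<^sub>M lborel) (case_prod H)"
  proof (rule integrable_strip)
    show "case_prod H \<in> borel_measurable (lborel \<Otimes>\<^sub>M lborel)"
      unfolding H_def by measurable
    show "\<bar>H t x\<bar> \<le> indicator {0..h} t * \<bar>g x\<bar>" for t x
      using \<psi>[of "x - t *\<^sub>R e"] by (auto simp: H_def abs_mult indicator_def intro: mult_left_le)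
  qed (use g in auto)
  have F_x: "(\<integral>t. F t x \<partial>lborel) = (LINT t:{0..h}|lborel. g (x + t *\<^sub>R e)) * \<psi> x" for x
    by (simp add: F_def set_lebesgue_integral_def mult.assoc[symmetric])
  have H_x: "(\<integral>t. H t x \<partial>lborel) = g x * (LINT t:{0..h}|lborel. \<psi> (x - t *\<^sub>R e))" for x
    by (simp add: H_def set_lebesgue_integral_def mult.left_commute)
  show "integrable lborel (\<lambda>x. (LINT t:{0..h}|lborel. g (x + t *\<^sub>R e)) * \<psi> x)"
    using lborel_pair.integrable_snd[OF F] by (simp add: F_x)
  have "(\<integral>x. F t x \<partial>lborel) = (\<integral>x. H t x \<partial>lborel)" for t
  proof -
    have [measurable]: "H t \<in> borel_measurable borel"
      unfolding H_def by measurable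
    have "(\<integral>x. F t x \<partial>lborel) = (\<integral>x. H t (x + t *\<^sub>R e) \<partial>lborel)"
      by (simp only: F_def H_def add_diff_cancel_right')
    then show ?thesis
      by (simp add: lborel_integral_translation)
  qed
  then show "(\<integral>x. (LINT t:{0..h}|lborel. g (x + t *\<^sub>R e)) * \<psi> x \<partial>lborel)
        = (\<integral>x. g x * (LINT t:{0..h}|lborel. \<psi> (x - t *\<^sub>R e)) \<partial>lborel)"
    using lborel_pair.Fubini_integral[OF F] lborel_pair.Fubini_integral[OF H] by (simp add: F_x H_x)
qed

text \<open>Passes from the weak formulation with Lebesgue measurable functions on \<open>\<Omega>\<close> to Borel functions
  on the whole space, for which Fubini is available.\<close>
lemma localized_set_integral:
  fixes f q :: "real^'n \<Rightarrow> real"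
  assumes "f absolutely_integrable_on B" and "B \<subseteq> \<Omega>" and q: "continuous_on UNIV q"
    and "\<And>x. x \<notin> B \<Longrightarrow> q x = 0"
    and [measurable]: "f0 \<in> borel_measurable borel"
    and ae: "AE x in lborel. f0 x = indicator B x * f x"
  shows "(LINT x:\<Omega>|lebesgue. f x * q x) = (\<integral>x. f0 x * q x \<partial>lborel)"
proof -
  have [measurable]: "q \<in> borel_measurable borel"
    using q by (rule borel_measurable_continuous_onI)
  have fB: "(\<lambda>x. indicator B x * f x) \<in> borel_measurable lebesgue"
    using assms(1) by (simp add: set_integrable_def borel_measurable_integrable)
  have "(LINT x:\<Omega>|lebesgue. f x * q x) = (\<integral>x. (indicator B x * f x) * q x \<partial>lebesgue)"
    unfolding set_lebesgue_integral_def
    by (intro Bochner_Integration.integral_cong) (use assms in \<open>auto simp: indicator_def\<close>)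
  also have "\<dots> = (\<integral>x. f0 x * q x \<partial>lebesgue)"
  proof (rule integral_cong_AE)
    show "AE x in lebesgue. (indicator B x * f x) * q x = f0 x * q x"
      by (rule AE_completion) (use ae in eventually_elim, simp)
    show "(\<lambda>x. (indicator B x * f x) * q x) \<in> borel_measurable lebesgue"
      by (intro borel_measurable_times fB measurable_completion) simp
    show "(\<lambda>x. f0 x * q x) \<in> borel_measurable lebesgue"
      by (intro measurable_completion) simp
  qed
  also have "\<dots> = (\<integral>x. f0 x * q x \<partial>lborel)"
    by (rule integral_completion) simp
  finally show ?thesis .
qed

text \<open>Almost every point is a limit of averages over shrinking cubes, and these averages vanish.\<close>
lemma AE_zero_from_box_integrals:
  fixes D :: "'a::euclidean_space \<Rightarrow> real"
  assumes D: "integrable lborel D"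
    and zero: "\<And>a b. cbox a b \<subseteq> ball z r \<Longrightarrow> (\<integral>x. D x * indicator (box a b) x \<partial>lborel) = 0"
  shows "AE x in lborel. x \<in> ball z r \<longrightarrow> D x = 0"
proof -
  have set_int: "set_integrable lborel S D" if "S \<in> sets borel" for S
    unfolding set_integrable_def using D that by (intro integrable_mult_indicator) auto
  have "D integrable_on cbox a b" for a b
    using set_borel_integral_eq_integral(1)[OF set_int] by simp
  then obtain N where N: "negligible N"
    and lim: "\<And>x e. x \<notin> N \<Longrightarrow> 0 < e \<Longrightarrow> \<exists>d>0. \<forall>h. 0 < h \<and> h < d \<longrightarrow>
       norm (integral (cbox x (x + h *\<^sub>R One)) D /\<^sub>R h ^ DIM('a) - D x) < e"
    using integrable_ccontinuous_explicit[of D] by blast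
  have "D x = 0" if "x \<notin> N" "x \<in> ball z r" for x
  proof (rule ccontr)
    assume "D x \<noteq> 0"
    then obtain d where d: "d > 0" "\<And>h. 0 < h \<Longrightarrow> h < d \<Longrightarrow>
       norm (integral (cbox x (x + h *\<^sub>R One)) D /\<^sub>R h ^ DIM('a) - D x) < \<bar>D x\<bar>"
      using lim[of x "\<bar>D x\<bar>"] \<open>x \<notin> N\<close> by auto
    obtain s where s: "s > 0" "ball x s \<subseteq> ball z r"
      using \<open>x \<in> ball z r\<close> open_ball openE by blast
    let ?One = "One :: 'a"
    have pos: "0 < norm ?One"
      by simp
    define h where "h = min d (s / norm ?One) / 2"
    have h: "0 < h" "h < d" "h * norm ?One < s"
      using d s pos by (auto simp: h_def min_def field_simps)
    have "cbox x (x + h *\<^sub>R ?One) \<subseteq> ball x s"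
    proof
      fix y assume y: "y \<in> cbox x (x + h *\<^sub>R ?One)"
      have "norm (y - x) \<le> norm (h *\<^sub>R ?One)"
        using y h by (intro norm_le_componentwise) (auto simp: mem_box inner_diff_left inner_add_left)
      then show "y \<in> ball x s"
        using h by (simp add: dist_norm norm_minus_commute)
    qed
    then have "cbox x (x + h *\<^sub>R ?One) \<subseteq> ball z r"
      using s by blast
    then have "(LINT y:box x (x + h *\<^sub>R ?One)|lborel. D y) = 0"
      using zero by (simp add: set_lebesgue_integral_def mult.commute)
    then have "integral (cbox x (x + h *\<^sub>R ?One)) D = 0"
      using set_borel_integral_eq_integral(2)[OF set_int, of "box x (x + h *\<^sub>R ?One)"]
      by (simp add: integral_open_interval)
    then show False
      using d(2)[OF h(1,2)] by simp
  qed
  then have "AE x in lebesgue. x \<in> ball z r \<longrightarrow> D x = 0"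
    using N by (intro AE_I'[of N]) (auto simp: negligible_iff_null_sets)
  then show ?thesis
    by (simp add: AE_completion_iff)
qed

text \<open>Weakly differentiable functions satisfy the fundamental theorem of calculus along almost every
  segment of fixed length h parallel to an axis. The difference D of the two sides is orthogonal to
  all bumps, by the weak formulation with the line integral of the bump as test function; hence its
  integral over every box vanishes.\<close>
lemma weak_deriv_line_integral:
  fixes f g :: "real^'n \<Rightarrow> real"
  assumes weak: "has_weak_deriv \<Omega> [k] f g"
    and sub: "cball z (2 * r) \<subseteq> \<Omega>" and h: "0 < h" "h < r"
    and f0: "integrable lborel f0" "AE x in lborel. f0 x = indicator (cball z (2 * r)) x * f x"
    and g0: "integrable lborel g0" "AE x in lborel. g0 x = indicator (cball z (2 * r)) x * g x"
  shows "AE x in lborel. x \<in> ball z r \<longrightarrow>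
    f0 (x + h *\<^sub>R axis k 1) - f0 x = (LINT t:{0..h}|lborel. g0 (x + t *\<^sub>R axis k 1))"
proof -
  define e where "e = (axis k 1 :: real^'n)"
  define A where "A x = (LINT t:{0..h}|lborel. g0 (x + t *\<^sub>R e))" for x
  define D where "D x = f0 (x + h *\<^sub>R e) - f0 x - A x" for x
  have [measurable]: "f0 \<in> borel_measurable borel" "g0 \<in> borel_measurable borel"
    using f0 g0 by (simp_all add: integrable_iff_bounded)
  have abs_int: "f absolutely_integrable_on cball z (2 * r)" "g absolutely_integrable_on cball z (2 * r)"
    using weak sub by (auto simp: has_weak_deriv_def locally_integrable_on_def)
  have A_int: "integrable lborel A"
    using integrable_line_integral[OF g0(1), of "\<lambda>x. 1" h e] by (simp add: A_def[abs_def])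
  have f0_shift: "integrable lborel (\<lambda>x. f0 (x + h *\<^sub>R e))"
    using f0(1) by (simp add: lborel_integrable_translation)
  have D_int: "integrable lborel D"
    unfolding D_def by (intro Bochner_Integration.integrable_diff f0_shift f0 A_int)
  have bump_meas [measurable]: "bump c a b \<in> borel_measurable borel" for c and a b :: "real^'n"
    by (rule borel_measurable_continuous_onI[OF continuous_on_bump])
  have bump_le: "\<bar>bump c a b x\<bar> \<le> 1" if "c > 0" for c and a b x :: "real^'n"
    using bump_bounds[OF that, of a b x] by (cases "x \<in> box a b") auto
  have int_bump: "integrable lborel (\<lambda>x. q x * bump c a b (x - y))"
    if "integrable lborel q" "c > 0" for q c and a b y :: "real^'n"
  proof (rule Bochner_Integration.integrable_bound[OF that(1)])
    have [measurable]: "q \<in> borel_measurable borel"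
      using that(1) by (simp add: integrable_iff_bounded)
    show "(\<lambda>x. q x * bump c a b (x - y)) \<in> borel_measurable lborel" by simp
    show "AE x in lborel. norm (q x * bump c a b (x - y)) \<le> norm (q x)"
      using bump_le[OF that(2)] by (intro AE_I2) (simp add: abs_mult mult_left_le)
  qed
  have bump_zero: "(\<integral>x. D x * bump c a b x \<partial>lborel) = 0" if "c > 0" and ab: "cbox a b \<subseteq> ball z r" for c a b
  proof -
    obtain \<phi> where \<phi>: "\<phi> \<in> bump_algebra"
      and d\<phi>: "\<And>x. partial_deriv k \<phi> x = bump c a b x - bump c a b (x - h *\<^sub>R e)"
      and \<phi>_eq: "\<And>x. \<phi> x = (LINT t:{0..h}|lborel. bump c a b (x - t *\<^sub>R e))"
      using bump_line_integral[OF h(1), where k=k and c=c and a=a and b=b] unfolding e_def by metis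
    \<comment> \<open>The box lies in the ball of radius r and h < r, so the line integral is supported in radius 2r.\<close>
    have far: "bump c a b (x - t *\<^sub>R e) = 0" if "x \<notin> cball z (2 * r)" "t \<in> {0..h}" for x t
    proof -
      have "x - t *\<^sub>R e \<notin> ball z r"
      proof
        assume "x - t *\<^sub>R e \<in> ball z r"
        then have "dist z (x - t *\<^sub>R e) < r" by simp
        moreover have "dist (x - t *\<^sub>R e) x \<le> h"
          using \<open>t \<in> {0..h}\<close> by (simp add: dist_norm e_def)
        moreover have "dist z x \<le> dist z (x - t *\<^sub>R e) + dist (x - t *\<^sub>R e) x"
          by (rule dist_triangle)
        ultimately have "dist z x \<le> 2 * r"
          using h by linarith
        then show False using \<open>x \<notin> cball z (2 * r)\<close> by simp
      qed
      then have "x - t *\<^sub>R e \<notin> box a b"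
        using ab box_subset_cbox by blast
      then show ?thesis
        using bump_bounds[OF \<open>c > 0\<close>, of a b "x - t *\<^sub>R e"] by simp
    qed
    have \<phi>_out: "\<phi> x = 0" if "x \<notin> cball z (2 * r)" for x
    proof -
      have "indicator {0..h} t *\<^sub>R bump c a b (x - t *\<^sub>R e) = 0" for t
        using far[OF that, of t] by (simp add: indicator_def)
      then show ?thesis
        unfolding \<phi>_eq set_lebesgue_integral_def by (simp only: Bochner_Integration.integral_zero)
    qed
    have d\<phi>_out: "partial_deriv k \<phi> x = 0" if "x \<notin> cball z (2 * r)" for x
      using far[OF that, of 0] far[OF that, of h] h by (simp add: d\<phi>)
    have "closure {x. \<phi> x \<noteq> 0} \<subseteq> cball z (2 * r)"
      using \<phi>_out by (intro closure_minimal closed_cball) blast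
    moreover from this have "compact (closure {x. \<phi> x \<noteq> 0})"
      using bounded_subset[OF bounded_cball] by (simp add: compact_eq_bounded_closed del: compact_closure)
    ultimately have test: "\<phi> \<in> test_functions \<Omega>"
      using sub bump_algebra_smooth[OF \<phi>] by (auto simp: test_functions_def)
    have cont: "continuous_on UNIV \<phi>" "continuous_on UNIV (partial_deriv k \<phi>)"
      by (intro continuous_at_imp_continuous_on ballI differentiable_imp_continuous_within
            smooth_differentiable smooth_partial_deriv bump_algebra_smooth \<phi>)+
    have "(\<integral>x. f0 x * partial_deriv k \<phi> x \<partial>lborel) = (LINT x:\<Omega>|lebesgue. f x * partial_deriv k \<phi> x)"
      using abs_int sub cont d\<phi>_out f0 by (intro localized_set_integral[symmetric]) auto
    also have "\<dots> = - (LINT x:\<Omega>|lebesgue. g x * \<phi> x)"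
      using weak test by (auto simp: has_weak_deriv_def iter_partial_def)
    also have "(LINT x:\<Omega>|lebesgue. g x * \<phi> x) = (\<integral>x. g0 x * \<phi> x \<partial>lborel)"
      using abs_int sub cont \<phi>_out g0 by (intro localized_set_integral) auto
    also have "\<dots> = (\<integral>x. A x * bump c a b x \<partial>lborel)"
      unfolding A_def \<phi>_eq by (rule integral_line_integral[symmetric, OF g0(1)]) (auto simp: bump_le \<open>c > 0\<close>)
    finally have "(\<integral>x. f0 x * (bump c a b x - bump c a b (x - h *\<^sub>R e)) \<partial>lborel)
        = - (\<integral>x. A x * bump c a b x \<partial>lborel)"
      by (simp add: d\<phi>)
    moreover have "(\<integral>x. f0 x * (bump c a b x - bump c a b (x - h *\<^sub>R e)) \<partial>lborel)
        = (\<integral>x. f0 x * bump c a b x \<partial>lborel) - (\<integral>x. f0 x * bump c a b (x - h *\<^sub>R e) \<partial>lborel)"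
      unfolding right_diff_distrib
      using int_bump[OF f0(1) \<open>c > 0\<close>, of a b 0] int_bump[OF f0(1) \<open>c > 0\<close>, of a b "h *\<^sub>R e"]
      by (intro Bochner_Integration.integral_diff) auto
    moreover have "(\<integral>x. f0 x * bump c a b (x - h *\<^sub>R e) \<partial>lborel) = (\<integral>x. f0 (x + h *\<^sub>R e) * bump c a b x \<partial>lborel)"
      using lborel_integral_translation[of "\<lambda>x. f0 x * bump c a b (x - h *\<^sub>R e)" "h *\<^sub>R e"] by simp
    moreover have "(\<integral>x. D x * bump c a b x \<partial>lborel) = (\<integral>x. f0 (x + h *\<^sub>R e) * bump c a b x \<partial>lborel)
        - (\<integral>x. f0 x * bump c a b x \<partial>lborel) - (\<integral>x. A x * bump c a b x \<partial>lborel)"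
      unfolding D_def left_diff_distrib
      using int_bump[OF f0(1) \<open>c > 0\<close>, of a b 0] int_bump[OF f0_shift \<open>c > 0\<close>, of a b 0]
        int_bump[OF A_int \<open>c > 0\<close>, of a b 0]
      by (simp add: Bochner_Integration.integral_diff)
    ultimately show ?thesis by simp
  qed
  have "(\<integral>x. D x * indicator (box a b) x \<partial>lborel) = 0" if ab: "cbox a b \<subseteq> ball z r" for a b
  proof -
    have [measurable]: "D \<in> borel_measurable borel"
      using D_int by (simp add: integrable_iff_bounded)
    have "(\<lambda>n. \<integral>x. D x * bump (real (Suc n)) a b x \<partial>lborel) \<longlonglongrightarrow> (\<integral>x. D x * indicator (box a b) x \<partial>lborel)"
    proof (rule integral_dominated_convergence)
      show "integrable lborel (\<lambda>x. \<bar>D x\<bar>)"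
        using D_int by simp
      show "AE x in lborel. (\<lambda>n. D x * bump (real (Suc n)) a b x) \<longlonglongrightarrow> D x * indicator (box a b) x"
        by (intro AE_I2 tendsto_mult tendsto_const bump_tendsto_indicator)
      show "AE x in lborel. norm (D x * bump (real (Suc n)) a b x) \<le> \<bar>D x\<bar>" for n
        using bump_le[of "real (Suc n)"] by (intro AE_I2) (simp add: abs_mult mult_left_le)
    qed measurable
    moreover have "(\<integral>x. D x * bump (real (Suc n)) a b x \<partial>lborel) = 0" for n
      by (rule bump_zero[OF _ ab]) simp
    ultimately show ?thesis
      using LIMSEQ_unique[OF _ tendsto_const] by fastforce
  qed
  then have "AE x in lborel. x \<in> ball z r \<longrightarrow> D x = 0"
    by (intro AE_zero_from_box_integrals D_int)
  then show ?thesis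
    by eventually_elim (simp add: D_def A_def e_def)
qed

lemma AE_lborel_translation:
  fixes c :: "'a::euclidean_space"
  assumes "AE x in lborel. P x"
  shows "AE x in lborel. P (x + c)"
proof -
  have "AE x in distr lborel borel ((+) c). P x"
    by (subst lborel_distr_plus) (rule assms)
  then have "AE x in lborel. P (c + x)"
    by (rule AE_distrD[rotated]) simp
  then show ?thesis by (simp add: add.commute)
qed

text \<open>Only countable quantifiers remain on the right, so the set of points where a sequence of
  measurable functions converges is measurable.\<close>
lemma LIMSEQ_iff_inverse_Suc:
  fixes L :: real
  shows "X \<longlonglongrightarrow> L \<longleftrightarrow> (\<forall>j::nat. \<exists>N::nat. \<forall>n. N \<le> n \<longrightarrow> \<bar>X n - L\<bar> < inverse (real (Suc j)))"
proof
  assume "X \<longlonglongrightarrow> L"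
  then show "\<forall>j::nat. \<exists>N::nat. \<forall>n. N \<le> n \<longrightarrow> \<bar>X n - L\<bar> < inverse (real (Suc j))"
    by (auto simp: LIMSEQ_iff)
next
  assume R: "\<forall>j::nat. \<exists>N::nat. \<forall>n. N \<le> n \<longrightarrow> \<bar>X n - L\<bar> < inverse (real (Suc j))"
  show "X \<longlonglongrightarrow> L"
  proof (rule LIMSEQ_I)
    fix e :: real assume "0 < e"
    then obtain j where "inverse (real (Suc j)) < e"
      using reals_Archimedean by blast
    with R show "\<exists>N. \<forall>n\<ge>N. norm (X n - L) < e"
      by (metis order_less_trans real_norm_def)
  qed
qed

text \<open>In dimension one the cubes of the differentiation theorem are intervals [s, s+h].\<close>
lemma right_averages_tendsto:
  fixes q :: "real \<Rightarrow> real"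
  assumes q: "integrable lborel q"
  shows "AE s in lborel. (\<lambda>n. real (Suc n) * (LINT t:{0..inverse (real (Suc n))}|lborel. q (s + t))) \<longlonglongrightarrow> q s"
proof -
  have [measurable]: "q \<in> borel_measurable borel"
    using q by (simp add: integrable_iff_bounded)
  have set_int: "set_integrable lborel S q" if "S \<in> sets borel" for S
    unfolding set_integrable_def using q that by (intro integrable_mult_indicator) auto
  have "q integrable_on cbox a b" for a b
    using set_borel_integral_eq_integral(1)[OF set_int] by simp
  then obtain N where N: "negligible N"
    and lim: "\<And>s e. s \<notin> N \<Longrightarrow> 0 < e \<Longrightarrow> \<exists>d>0. \<forall>h. 0 < h \<and> h < d \<longrightarrow>
       norm (integral (cbox s (s + h *\<^sub>R One)) q /\<^sub>R h ^ DIM(real) - q s) < e"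
    using integrable_ccontinuous_explicit[of q] by blast
  have avg: "integral {s..s + h} q = (LINT t:{0..h}|lborel. q (s + t))" for s h :: real
  proof -
    have "integral {s..s + h} q = (\<integral>t. indicator {s..s + h} t * q t \<partial>lborel)"
      using set_borel_integral_eq_integral(2)[OF set_int, of "{s..s + h}"]
      by (simp add: set_lebesgue_integral_def)
    also have "\<dots> = (\<integral>t. indicator {s..s + h} (t + s) * q (t + s) \<partial>lborel)"
      by (rule lborel_integral_translation[symmetric]) measurable
    also have "\<dots> = (\<integral>t. indicator {0..h} t * q (s + t) \<partial>lborel)"
      by (intro Bochner_Integration.integral_cong) (auto simp: indicator_def add.commute)
    finally show ?thesis by (simp add: set_lebesgue_integral_def)
  qed
  have "(\<lambda>n. real (Suc n) * (LINT t:{0..inverse (real (Suc n))}|lborel. q (s + t))) \<longlonglongrightarrow> q s" if "s \<notin> N" for s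
  proof (rule LIMSEQ_I)
    fix e :: real assume "0 < e"
    then obtain d where d: "d > 0" "\<And>h. 0 < h \<Longrightarrow> h < d \<Longrightarrow>
       norm (integral (cbox s (s + h *\<^sub>R One)) q /\<^sub>R h ^ DIM(real) - q s) < e"
      using lim[OF \<open>s \<notin> N\<close> \<open>0 < e\<close>] by blast
    obtain M where "inverse (real (Suc M)) < d"
      using reals_Archimedean[OF d(1)] by blast
    have "norm (real (Suc n) * (LINT t:{0..inverse (real (Suc n))}|lborel. q (s + t)) - q s) < e" if "n \<ge> M" for n
    proof -
      have "inverse (real (Suc n)) \<le> inverse (real (Suc M))"
        using that by (simp add: field_simps)
      then have "inverse (real (Suc n)) < d"
        using \<open>inverse (real (Suc M)) < d\<close> by linarith
      then show ?thesis
        using d(2)[of "inverse (real (Suc n))"] by (simp add: avg)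
    qed
    then show "\<exists>M. \<forall>n\<ge>M. norm (real (Suc n) * (LINT t:{0..inverse (real (Suc n))}|lborel. q (s + t)) - q s) < e"
      by blast
  qed
  then have "AE s in lebesgue. (\<lambda>n. real (Suc n) * (LINT t:{0..inverse (real (Suc n))}|lborel. q (s + t))) \<longlonglongrightarrow> q s"
    using N by (intro AE_I'[of N]) (auto simp: negligible_iff_null_sets)
  then show ?thesis
    by (simp add: AE_completion_iff)
qed

text \<open>The one-dimensional differentiation theorem holds on the line through almost every point x, so
  for almost every x the claim holds at \<open>x + s *\<^sub>R e\<close> for almost every s in [0,1]. Exchanging the
  two quantifiers yields one s that serves almost every x, and a translation removes it.\<close>
lemma line_averages_tendsto:
  fixes g :: "'a::euclidean_space \<Rightarrow> real"
  assumes g: "integrable lborel g"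
  shows "AE x in lborel.
    (\<lambda>n. real (Suc n) * (LINT t:{0..inverse (real (Suc n))}|lborel. g (x + t *\<^sub>R e))) \<longlonglongrightarrow> g x"
    (is "AE x in lborel. ?P x")
proof -
  have [measurable]: "g \<in> borel_measurable borel"
    using g by (simp add: integrable_iff_bounded)
  have P_meas [measurable]: "Measurable.pred borel ?P"
    unfolding LIMSEQ_iff_inverse_Suc set_lebesgue_integral_def by measurable
  \<comment> \<open>For s and h at most 1 the segment from s to s + h stays in [0,2].\<close>
  have "integrable (lborel \<Otimes>\<^sub>M lborel) (\<lambda>(t, x). indicator {0..2} t * g (x + t *\<^sub>R e))"
  proof (rule integrable_strip)
    show "integrable lborel (\<lambda>x. \<bar>g (x + t *\<^sub>R e)\<bar>)" for t
      using g by (intro integrable_abs) (simp add: lborel_integrable_translation)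
    show "(\<integral>x. \<bar>g (x + t *\<^sub>R e)\<bar> \<partial>lborel) = (\<integral>x. \<bar>g x\<bar> \<partial>lborel)" for t
      by (rule lborel_integral_translation) measurable
  qed (auto simp: abs_mult)
  then have "AE x in lborel. integrable lborel (\<lambda>t. indicator {0..2} t * g (x + t *\<^sub>R e))"
    using lborel_pair.AE_integrable_snd by force
  then have "AE x in lborel. AE s in lborel. s \<in> {0..1} \<longrightarrow> ?P (x + s *\<^sub>R e)"
  proof eventually_elim
    fix x
    define q where "q t = indicator {0..2} t * g (x + t *\<^sub>R e)" for t
    assume "integrable lborel (\<lambda>t. indicator {0..2} t * g (x + t *\<^sub>R e))"
    then have "AE s in lborel. (\<lambda>n. real (Suc n) * (LINT t:{0..inverse (real (Suc n))}|lborel. q (s + t))) \<longlonglongrightarrow> q s"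
      unfolding q_def by (rule right_averages_tendsto)
    then show "AE s in lborel. s \<in> {0..1} \<longrightarrow> ?P (x + s *\<^sub>R e)"
    proof eventually_elim
      case (elim s)
      show ?case
      proof
        assume s: "s \<in> {0..1::real}"
        have le: "inverse (real (Suc n)) \<le> 1" for n
          by (simp add: field_simps)
        have "(LINT t:{0..inverse (real (Suc n))}|lborel. q (s + t))
            = (LINT t:{0..inverse (real (Suc n))}|lborel. g (x + s *\<^sub>R e + t *\<^sub>R e))" for n
          using s le[of n]
          by (intro set_lebesgue_integral_cong) (auto simp: q_def algebra_simps indicator_def)
        then show "?P (x + s *\<^sub>R e)"
          using elim s by (simp add: q_def)
      qed
    qed
  qed
  then have AE_s: "AE s in lborel. AE x in lborel. s \<in> {0..1} \<longrightarrow> ?P (x + s *\<^sub>R e)"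
    by (subst lborel_pair.AE_commute) measurable
  have "\<exists>s. AE x in lborel. ?P (x + s *\<^sub>R e)"
  proof (rule ccontr)
    assume none: "\<nexists>s. AE x in lborel. ?P (x + s *\<^sub>R e)"
    from AE_s have "AE s in lborel. s \<notin> {0..1::real}"
    proof eventually_elim
      case (elim s)
      then show ?case using none by (cases "s \<in> {0..1}") auto
    qed
    then have "emeasure lborel {0..1::real} = 0"
      by (subst (asm) AE_iff_measurable[of "{0..1}"]) auto
    then show False by simp
  qed
  then obtain s where "AE x in lborel. ?P (x + s *\<^sub>R e)" ..
  then have "AE x in lborel. ?P (x + (- (s *\<^sub>R e)) + s *\<^sub>R e)"
    by (rule AE_lborel_translation)
  then show ?thesis by simp
qed

section \<open>Difference quotients of weakly differentiable functions\<close>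

lemma borel_representative:
  fixes f :: "'a::euclidean_space \<Rightarrow> real"
  assumes "f absolutely_integrable_on B"
  obtains f0 where "integrable lborel f0" "AE x in lborel. f0 x = indicator B x * f x"
proof -
  have f: "integrable lebesgue (\<lambda>x. indicator B x * f x)"
    using assms by (simp add: set_integrable_def)
  then obtain f0 where f0: "f0 \<in> borel_measurable lborel" "AE x in lborel. indicator B x * f x = f0 x"
    using completion_ex_borel_measurable_real[OF borel_measurable_integrable[OF f]] by auto
  have "integrable lebesgue f0"
  proof (rule integrable_cong_AE_imp[OF f])
    show "f0 \<in> borel_measurable lebesgue"
      using f0(1) by (rule measurable_completion)
    show "AE x in lebesgue. indicator B x * f x = f0 x"
      by (rule AE_completion) (use f0(2) in eventually_elim, simp)
  qed
  then have "integrable lborel f0"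
    using f0(1) by (simp add: integrable_completion)
  moreover have "AE x in lborel. f0 x = indicator B x * f x"
    using f0(2) by eventually_elim simp
  ultimately show thesis by (rule that)
qed

text \<open>Combines the fundamental theorem along segments with the differentiation of line averages.
  The countably many step lengths 1/(n+1) keep the union of the exceptional sets null.\<close>
lemma weak_deriv_quotients_tendsto_ball:
  fixes f g :: "real^'n \<Rightarrow> real"
  assumes weak: "has_weak_deriv \<Omega> [k] f g" and r: "r > 0" and sub: "cball z (2 * r) \<subseteq> \<Omega>"
  shows "AE x in lborel. x \<in> ball z r \<longrightarrow>
    (\<lambda>n. real (Suc n) * (f (x + inverse (real (Suc n)) *\<^sub>R axis k 1) - f x)) \<longlonglongrightarrow> g x"
proof -
  define B where "B = cball z (2 * r)"
  define e where "e = (axis k 1 :: real^'n)"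
  define h where "h n = inverse (real (Suc n))" for n
  have abs_int: "f absolutely_integrable_on B" "g absolutely_integrable_on B"
    using weak sub by (auto simp: has_weak_deriv_def locally_integrable_on_def B_def)
  obtain f0 where f0: "integrable lborel f0" "AE x in lborel. f0 x = indicator B x * f x"
    using borel_representative[OF abs_int(1)] by blast
  obtain g0 where g0: "integrable lborel g0" "AE x in lborel. g0 x = indicator B x * g x"
    using borel_representative[OF abs_int(2)] by blast
  have line: "AE x in lborel. \<forall>n. h n < r \<longrightarrow> x \<in> ball z r \<longrightarrow>
      f0 (x + h n *\<^sub>R e) - f0 x = (LINT t:{0..h n}|lborel. g0 (x + t *\<^sub>R e))"
  proof (subst AE_all_countable, intro allI)
    fix n
    show "AE x in lborel. h n < r \<longrightarrow> x \<in> ball z r \<longrightarrow>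
      f0 (x + h n *\<^sub>R e) - f0 x = (LINT t:{0..h n}|lborel. g0 (x + t *\<^sub>R e))"
    proof (cases "h n < r")
      case True
      moreover have "0 < h n" by (simp add: h_def)
      ultimately show ?thesis
        using weak_deriv_line_integral[OF weak sub _ _ f0[unfolded B_def] g0[unfolded B_def], of "h n"]
        by (simp add: e_def)
    qed simp
  qed
  have shifted: "AE x in lborel. \<forall>n. f0 (x + h n *\<^sub>R e) = indicator B (x + h n *\<^sub>R e) * f (x + h n *\<^sub>R e)"
    by (subst AE_all_countable) (intro allI AE_lborel_translation f0)
  have average: "AE x in lborel. (\<lambda>n. real (Suc n) * (LINT t:{0..h n}|lborel. g0 (x + t *\<^sub>R e))) \<longlonglongrightarrow> g0 x"
    unfolding h_def by (rule line_averages_tendsto[OF g0(1)])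
  have small: "\<forall>\<^sub>F n in sequentially. h n < r"
    unfolding h_def by (rule order_tendstoD(2)[OF LIMSEQ_inverse_real_of_nat r])
  show ?thesis
    using line shifted average f0(2) g0(2)
  proof eventually_elim
    case (elim x)
    note line_x = elim(1)[rule_format] and shifted_x = elim(2)[rule_format]
    show ?case
    proof
      assume x: "x \<in> ball z r"
      then have "x \<in> B" using r by (simp add: B_def)
      then have f0_x: "f0 x = f x"
        using elim(4) by simp
      have "\<forall>\<^sub>F n in sequentially. real (Suc n) * (LINT t:{0..h n}|lborel. g0 (x + t *\<^sub>R e))
          = real (Suc n) * (f (x + h n *\<^sub>R e) - f x)"
        using small
      proof eventually_elim
        case (elim n)
        have "dist z (x + h n *\<^sub>R e) \<le> dist z x + dist x (x + h n *\<^sub>R e)"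
          by (rule dist_triangle)
        also have "dist x (x + h n *\<^sub>R e) = h n"
          by (simp add: dist_norm e_def h_def)
        finally have "x + h n *\<^sub>R e \<in> B"
          using x elim by (simp add: B_def)
        then have "f0 (x + h n *\<^sub>R e) = f (x + h n *\<^sub>R e)"
          by (simp add: shifted_x)
        then show ?case
          using line_x[OF elim x] f0_x by simp
      qed
      then have "(\<lambda>n. real (Suc n) * (f (x + h n *\<^sub>R e) - f x)) \<longlonglongrightarrow> g0 x"
        by (rule Lim_transform_eventually[OF elim(3)])
      then show "(\<lambda>n. real (Suc n) * (f (x + inverse (real (Suc n)) *\<^sub>R axis k 1) - f x)) \<longlonglongrightarrow> g x"
        using elim(5) \<open>x \<in> B\<close> by (simp add: h_def e_def)
    qed
  qed
qed

text \<open>This is the form in which weak derivatives are used: as pointwise limits of difference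
  quotients. It turns almost everywhere algebraic relations between weakly differentiable functions
  into relations between their derivatives, although products of such functions need not be
  locally integrable.\<close>
lemma weak_deriv_quotients_tendsto:
  fixes f g :: "real^'n \<Rightarrow> real"
  assumes "open \<Omega>" and weak: "has_weak_deriv \<Omega> [k] f g"
  shows "AE x in lborel. x \<in> \<Omega> \<longrightarrow>
    (\<lambda>n. real (Suc n) * (f (x + inverse (real (Suc n)) *\<^sub>R axis k 1) - f x)) \<longlonglongrightarrow> g x"
    (is "AE x in lborel. x \<in> \<Omega> \<longrightarrow> ?P x")
proof -
  define \<F> where "\<F> = {ball z r | z r. r > 0 \<and> cball z (2 * r) \<subseteq> \<Omega>}"
  obtain \<F>' where \<F>': "\<F>' \<subseteq> \<F>" "countable \<F>'" "\<Union>\<F>' = \<Union>\<F>"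
    using Lindelof[of \<F>] by (auto simp: \<F>_def)
  have "\<Omega> \<subseteq> \<Union>\<F>"
  proof
    fix x assume "x \<in> \<Omega>"
    then obtain d where d: "d > 0" "cball x d \<subseteq> \<Omega>"
      using \<open>open \<Omega>\<close> open_contains_cball by blast
    then have "ball x (d/2) \<in> \<F>" "x \<in> ball x (d/2)"
      unfolding \<F>_def by (auto intro!: exI[of _ x] exI[of _ "d/2"])
    then show "x \<in> \<Union>\<F>" by blast
  qed
  have "AE x in lborel. \<forall>S\<in>\<F>'. x \<in> S \<longrightarrow> ?P x"
  proof (subst AE_ball_countable[OF \<F>'(2)], intro ballI)
    fix S assume "S \<in> \<F>'"
    then obtain z r where "S = ball z r" "r > 0" "cball z (2 * r) \<subseteq> \<Omega>"
      using \<F>' by (auto simp: \<F>_def)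
    then show "AE x in lborel. x \<in> S \<longrightarrow> ?P x"
      using weak_deriv_quotients_tendsto_ball[OF weak] by blast
  qed
  then show ?thesis
    by eventually_elim (use \<open>\<Omega> \<subseteq> \<Union>\<F>\<close> \<F>'(3) in blast)
qed

section \<open>Parallel one-forms with a common exterior derivative\<close>

text \<open>Convergence of the quotients forces convergence of the functions themselves, so the usual
  proof of the product rule works along a fixed sequence of steps.\<close>
lemma product_rule_from_quotients:
  fixes p q p' q' :: "nat \<Rightarrow> real"
  assumes quot: "(\<lambda>n. real (Suc n) * (p n - p0)) \<longlonglongrightarrow> P" "(\<lambda>n. real (Suc n) * (q n - q0)) \<longlonglongrightarrow> Q"
    "(\<lambda>n. real (Suc n) * (p' n - p0')) \<longlonglongrightarrow> P'" "(\<lambda>n. real (Suc n) * (q' n - q0')) \<longlonglongrightarrow> Q'"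
    and eq: "\<forall>\<^sub>F n in sequentially. p n * q n = p' n * q' n" and eq0: "p0 * q0 = p0' * q0'"
  shows "P * q0 + p0 * Q = P' * q0' + p0' * Q'"
proof -
  have prod: "(\<lambda>n. real (Suc n) * (p n * q n - p0 * q0)) \<longlonglongrightarrow> P * q0 + p0 * Q"
    if "(\<lambda>n. real (Suc n) * (p n - p0)) \<longlonglongrightarrow> P" "(\<lambda>n. real (Suc n) * (q n - q0)) \<longlonglongrightarrow> Q"
    for p q :: "nat \<Rightarrow> real" and p0 q0 P Q
  proof -
    have "(\<lambda>n. inverse (real (Suc n)) * (real (Suc n) * (q n - q0)) + q0) \<longlonglongrightarrow> 0 * Q + q0"
      by (intro tendsto_intros LIMSEQ_inverse_real_of_nat that)
    then have "q \<longlonglongrightarrow> q0"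
      by (simp add: mult.assoc[symmetric] del: of_nat_Suc)
    then have "(\<lambda>n. (real (Suc n) * (p n - p0)) * q n + p0 * (real (Suc n) * (q n - q0))) \<longlonglongrightarrow> P * q0 + p0 * Q"
      by (intro tendsto_intros that)
    then show ?thesis
      by (simp add: algebra_simps)
  qed
  have "\<forall>\<^sub>F n in sequentially. real (Suc n) * (p n * q n - p0 * q0) = real (Suc n) * (p' n * q' n - p0' * q0')"
    using eq by eventually_elim (simp add: eq0)
  then have "(\<lambda>n. real (Suc n) * (p' n * q' n - p0' * q0')) \<longlonglongrightarrow> P * q0 + p0 * Q"
    by (rule Lim_transform_eventually[OF prod[OF quot(1,2)]])
  then show ?thesis
    using prod[OF quot(3,4)] LIMSEQ_unique by blast
qed

text \<open>The hypothesis says that the two-form with coefficients \<open>\<Phi>\<close> is the wedge of c with p;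
  its wedge with p therefore contains p twice.\<close>
lemma wedge_zero_from_proportionality:
  fixes p c :: "real^'n" and \<Phi> :: "'n \<Rightarrow> 'n \<Rightarrow> real"
  assumes "\<And>i k. \<Phi> i k - \<Phi> k i = p $ i * c $ k - p $ k * c $ i"
  shows "wedge12 (\<lambda>X. s * (\<Sum>i\<in>UNIV. p $ i * X $ i))
    (\<lambda>X Y. \<Sum>i\<in>UNIV. \<Sum>j\<in>UNIV. \<Phi> i j * wedge11 (dx j) (dx i) X Y) = (\<lambda>X Y Z. 0)"
proof -
  define \<theta> where "\<theta> X = (\<Sum>i\<in>UNIV. p $ i * X $ i)" for X :: "real^'n"
  define \<delta> where "\<delta> X = (\<Sum>i\<in>UNIV. c $ i * X $ i)" for X :: "real^'n"
  have two_form: "(\<Sum>i\<in>UNIV. \<Sum>j\<in>UNIV. \<Phi> i j * wedge11 (dx j) (dx i) X Y) = \<theta> Y * \<delta> X - \<theta> X * \<delta> Y" for X Y :: "real^'n"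
  proof -
    have "(\<Sum>i\<in>UNIV. \<Sum>j\<in>UNIV. \<Phi> i j * wedge11 (dx j) (dx i) X Y)
        = (\<Sum>i\<in>UNIV. \<Sum>j\<in>UNIV. \<Phi> i j * (X $ j * Y $ i)) - (\<Sum>i\<in>UNIV. \<Sum>j\<in>UNIV. \<Phi> i j * (Y $ j * X $ i))"
      by (simp add: wedge11_def dx_def right_diff_distrib sum_subtractf)
    also have "(\<Sum>i\<in>UNIV. \<Sum>j\<in>UNIV. \<Phi> i j * (Y $ j * X $ i)) = (\<Sum>i\<in>UNIV. \<Sum>j\<in>UNIV. \<Phi> j i * (Y $ i * X $ j))"
      by (rule sum.swap)
    also have "(\<Sum>i\<in>UNIV. \<Sum>j\<in>UNIV. \<Phi> i j * (X $ j * Y $ i)) - \<dots>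
        = (\<Sum>i\<in>UNIV. \<Sum>j\<in>UNIV. (\<Phi> i j - \<Phi> j i) * (X $ j * Y $ i))"
      by (simp add: sum_subtractf[symmetric] algebra_simps)
    also have "\<dots> = (\<Sum>i\<in>UNIV. \<Sum>j\<in>UNIV. (p $ i * Y $ i) * (c $ j * X $ j))
        - (\<Sum>i\<in>UNIV. \<Sum>j\<in>UNIV. (p $ j * X $ j) * (c $ i * Y $ i))"
      by (simp add: assms sum_subtractf[symmetric] algebra_simps)
    also have "\<dots> = \<theta> Y * \<delta> X - \<theta> X * \<delta> Y"
      unfolding \<theta>_def \<delta>_def sum_product by (subst (2) sum.swap) simp
    finally show ?thesis .
  qed
  show ?thesis
    unfolding \<theta>_def[symmetric] wedge12_def two_form by (intro ext) (simp add: algebra_simps)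
qed

text \<open>Here p and \<open>\<gamma> * p\<close> are the values of the two one-forms at a point, U and V the Hessians of the
  two functions, \<open>\<Phi>\<close> the derivative of the vector field, and the rule is the derivative of the
  relation expressing parallelism. It makes the matrix M proportional to p in its first index,
  and antisymmetrising kills the Hessians: \<open>\<gamma> - 1\<close> times the exterior derivative is
  divisible by p.\<close>
lemma proportionality_factor_eq_1:
  fixes p :: "real^'n" and U V \<Phi> :: "'n \<Rightarrow> 'n \<Rightarrow> real"
  assumes "p \<noteq> 0"
    and sym: "\<And>i k. U i k = U k i" "\<And>i k. V i k = V k i"
    and rule: "\<And>i j k. (U i k + \<Phi> i k) * (\<gamma> * p $ j) + p $ i * (V j k + \<Phi> j k)
       = (U j k + \<Phi> j k) * (\<gamma> * p $ i) + p $ j * (V i k + \<Phi> i k)"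
    and nonint: "wedge12 (\<lambda>X. s * (\<Sum>i\<in>UNIV. p $ i * X $ i))
       (\<lambda>X Y. \<Sum>i\<in>UNIV. \<Sum>j\<in>UNIV. \<Phi> i j * wedge11 (dx j) (dx i) X Y) \<noteq> (\<lambda>X Y Z. 0)"
  shows "\<gamma> = 1"
proof (rule ccontr)
  assume "\<gamma> \<noteq> 1"
  obtain l where l: "p $ l \<noteq> 0"
    using \<open>p \<noteq> 0\<close> by (auto simp: vec_eq_iff)
  define M where "M i k = \<gamma> * (U i k + \<Phi> i k) - (V i k + \<Phi> i k)" for i k
  \<comment> \<open>M i k is p i times a vector in k, which is read off from the row of a nonzero entry p l.\<close>
  define c :: "real^'n" where "c = (\<chi> k. M l k / (p $ l * (\<gamma> - 1)))"
  have "p $ j * M i k = p $ i * M j k" for i j k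
    using rule[of i k j] by (simp add: M_def algebra_simps)
  then have M_eq: "M i k = (\<gamma> - 1) * (p $ i * c $ k)" for i k
    using l \<open>\<gamma> \<noteq> 1\<close> by (simp add: c_def field_simps)
  have "(\<gamma> - 1) * (\<Phi> i k - \<Phi> k i) = M i k - M k i" for i k
    using sym(1)[of i k] sym(2)[of i k] by (simp add: M_def algebra_simps)
  then have "(\<gamma> - 1) * (\<Phi> i k - \<Phi> k i) = (\<gamma> - 1) * (p $ i * c $ k - p $ k * c $ i)" for i k
    by (simp add: M_eq right_diff_distrib)
  then have "\<Phi> i k - \<Phi> k i = p $ i * c $ k - p $ k * c $ i" for i k
    using \<open>\<gamma> \<noteq> 1\<close> by simp
  then show False
    using wedge_zero_from_proportionality nonint by blast
qed

lemma has_weak_deriv_weak_deriv: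
  assumes "f \<in> W k \<Omega>" "length \<alpha> \<le> k"
  shows "has_weak_deriv \<Omega> \<alpha> f (weak_deriv \<Omega> \<alpha> f)"
proof -
  have "\<exists>g. has_weak_deriv \<Omega> \<alpha> f g"
    using assms by (auto simp: W_def)
  then show ?thesis
    unfolding weak_deriv_def by (rule someI_ex)
qed

lemma has_weak_deriv_swap:
  assumes "has_weak_deriv \<Omega> [i, j] f g"
  shows "has_weak_deriv \<Omega> [j, i] f g"
proof -
  have "iter_partial [j, i] \<phi> = iter_partial [i, j] \<phi>" if "\<phi> \<in> test_functions \<Omega>" for \<phi>
    using smooth_partial_deriv_commute[of \<phi> i j] that
    by (simp add: iter_partial_def test_functions_def)
  then show ?thesis
    using assms by (simp add: has_weak_deriv_def)
qed

text \<open>The partial derivative of a test function is a test function, so a second derivative is a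
  derivative of the first one.\<close>
lemma has_weak_deriv_second:
  assumes f: "has_weak_deriv \<Omega> [i] f f'" and f2: "has_weak_deriv \<Omega> [i, j] f f''"
  shows "has_weak_deriv \<Omega> [j] f' f''"
  unfolding has_weak_deriv_def
proof (intro conjI ballI)
  show "f' locally_integrable_on \<Omega>" "f'' locally_integrable_on \<Omega>"
    using assms by (auto simp: has_weak_deriv_def)
  fix \<phi> assume \<phi>: "\<phi> \<in> test_functions \<Omega>"
  have "(LINT x:\<Omega>|lebesgue. f x * partial_deriv i (partial_deriv j \<phi>) x)
      = - (LINT x:\<Omega>|lebesgue. f' x * partial_deriv j \<phi> x)"
    using f test_function_partial_deriv[OF \<phi>, of j]
    by (auto simp: has_weak_deriv_def iter_partial_def)
  moreover have "(LINT x:\<Omega>|lebesgue. f x * partial_deriv i (partial_deriv j \<phi>) x)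
      = (LINT x:\<Omega>|lebesgue. f'' x * \<phi> x)"
    using f2 \<phi> by (auto simp: has_weak_deriv_def iter_partial_def)
  ultimately show "(LINT x:\<Omega>|lebesgue. f' x * iter_partial [j] \<phi> x)
      = (- 1) ^ length [j] * (LINT x:\<Omega>|lebesgue. f'' x * \<phi> x)"
    by (simp add: iter_partial_def)
qed

text \<open>The weak form of d(dw) = 0: a symmetric Hessian exists.\<close>
lemma second_weak_derivs:
  assumes "w \<in> W 2 \<Omega>"
  obtains H where "\<And>i k. has_weak_deriv \<Omega> [k] (weak_deriv \<Omega> [i] w) (H i k)"
    and "\<And>i k. H i k = H k i"
proof -
  have "has_weak_deriv \<Omega> [i, k] w (weak_deriv \<Omega> [i, k] w)" for i k
    using assms by (intro has_weak_deriv_weak_deriv) auto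
  moreover have first: "has_weak_deriv \<Omega> [i] w (weak_deriv \<Omega> [i] w)" for i
    using assms by (intro has_weak_deriv_weak_deriv) auto
  moreover have "weak_deriv \<Omega> [i, k] w = weak_deriv \<Omega> [k, i] w" for i k
  proof -
    have "has_weak_deriv \<Omega> [i, k] w = has_weak_deriv \<Omega> [k, i] w"
      using has_weak_deriv_swap by blast
    then show ?thesis by (simp add: weak_deriv_def)
  qed
  ultimately show thesis
    by (intro that[of "\<lambda>i k. weak_deriv \<Omega> [i, k] w"]) (auto intro: has_weak_deriv_second)
qed

lemma AE_lebesgue_on_iff:
  assumes "open \<Omega>"
  shows "(AE x in lebesgue_on \<Omega>. P x) \<longleftrightarrow> (AE x in lborel. x \<in> \<Omega> \<longrightarrow> P x)"
  using assms by (simp add: AE_restrict_space_iff AE_completion_iff)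

theorem mainTheorem6:
  fixes \<Omega> :: "(real^'n) set" and u v :: "real^'n \<Rightarrow> real"
    and F :: "real^'n \<Rightarrow> real^'n" and C :: real
  assumes "open \<Omega>" and "connected \<Omega>" and "\<Omega> \<noteq> {}"
    and "u \<in> W 2 \<Omega>" and "v \<in> W 2 \<Omega>" and "F \<in> W_vec 1 \<Omega>"
    and "C > 0"
    and "AE x in lebesgue_on \<Omega>. norm (weak_grad \<Omega> u x + F x) \<ge> C"
    and "AE x in lebesgue_on \<Omega>. norm (weak_grad \<Omega> v x + F x) \<ge> C"
    and "AE x in lebesgue_on \<Omega>. N \<Omega> F u x = N \<Omega> F v x"
    and "nonintegrable \<Omega> F u \<or> nonintegrable \<Omega> F v"
  shows "AE x in lebesgue_on \<Omega>. weak_grad \<Omega> u x = weak_grad \<Omega> v x"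
proof -
  define a where "a x = weak_grad \<Omega> u x + F x" for x
  define b where "b x = weak_grad \<Omega> v x + F x" for x
  obtain U where U: "\<And>i k. has_weak_deriv \<Omega> [k] (weak_deriv \<Omega> [i] u) (U i k)" "\<And>i k. U i k = U k i"
    using second_weak_derivs[OF \<open>u \<in> W 2 \<Omega>\<close>] by blast
  obtain V where V: "\<And>i k. has_weak_deriv \<Omega> [k] (weak_deriv \<Omega> [i] v) (V i k)" "\<And>i k. V i k = V k i"
    using second_weak_derivs[OF \<open>v \<in> W 2 \<Omega>\<close>] by blast
  define \<Phi> where "\<Phi> i k = weak_deriv \<Omega> [k] (\<lambda>y. F y $ i)" for i k
  have \<Phi>: "has_weak_deriv \<Omega> [k] (\<lambda>y. F y $ i) (\<Phi> i k)" for i k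
    unfolding \<Phi>_def using \<open>F \<in> W_vec 1 \<Omega>\<close>
    by (intro has_weak_deriv_weak_deriv[of _ 1]) (auto simp: W_vec_def)
  define shift where "shift k n x = x + inverse (real (Suc n)) *\<^sub>R axis k 1" for k n and x :: "real^'n"
  have quotients: "AE x in lborel. \<forall>i k. x \<in> \<Omega> \<longrightarrow>
      (\<lambda>n. real (Suc n) * (w i (shift k n x) - w i x)) \<longlonglongrightarrow> w' i k x"
    if "\<And>i k. has_weak_deriv \<Omega> [k] (w i) (w' i k)"
    for w :: "'n \<Rightarrow> real^'n \<Rightarrow> real" and w' :: "'n \<Rightarrow> 'n \<Rightarrow> real^'n \<Rightarrow> real"
    unfolding AE_all_countable shift_def
    by (intro allI weak_deriv_quotients_tendsto[OF \<open>open \<Omega>\<close> that])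
  have proportional: "AE x in lborel. x \<in> \<Omega> \<longrightarrow> a x \<noteq> 0 \<and> b x = (norm (b x) / norm (a x)) *\<^sub>R a x"
  proof -
    have "AE x in lborel. x \<in> \<Omega> \<longrightarrow> norm (a x) \<ge> C" "AE x in lborel. x \<in> \<Omega> \<longrightarrow> norm (b x) \<ge> C"
      "AE x in lborel. x \<in> \<Omega> \<longrightarrow> a x /\<^sub>R norm (a x) = b x /\<^sub>R norm (b x)"
      using assms(8-10) by (simp_all add: AE_lebesgue_on_iff[OF \<open>open \<Omega>\<close>] a_def b_def N_def)
    then show ?thesis
    proof eventually_elim
      case (elim x)
      show ?case
      proof
        assume "x \<in> \<Omega>"
        with elim \<open>C > 0\<close> have nz: "norm (a x) > 0" "norm (b x) > 0"
          and eq: "a x /\<^sub>R norm (a x) = b x /\<^sub>R norm (b x)" by auto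
        have "b x = norm (b x) *\<^sub>R (b x /\<^sub>R norm (b x))"
          using nz by simp
        also have "\<dots> = (norm (b x) / norm (a x)) *\<^sub>R a x"
          unfolding eq[symmetric] by (simp add: divide_inverse)
        finally show "a x \<noteq> 0 \<and> b x = (norm (b x) / norm (a x)) *\<^sub>R a x"
          using nz by auto
      qed
    qed
  qed
  have proportional_shift: "AE x in lborel. \<forall>k n. shift k n x \<in> \<Omega> \<longrightarrow>
      b (shift k n x) = (norm (b (shift k n x)) / norm (a (shift k n x))) *\<^sub>R a (shift k n x)"
    unfolding AE_all_countable
  proof (intro allI)
    fix k n
    show "AE x in lborel. shift k n x \<in> \<Omega> \<longrightarrow>
        b (shift k n x) = (norm (b (shift k n x)) / norm (a (shift k n x))) *\<^sub>R a (shift k n x)"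
      using AE_lborel_translation[OF proportional, of "inverse (real (Suc n)) *\<^sub>R axis k 1"]
      unfolding shift_def by eventually_elim blast
  qed
  have Theta_u: "Theta \<Omega> F u x = (\<lambda>X. 1 * (\<Sum>i\<in>UNIV. a x $ i * X $ i))" for x
    by (simp add: fun_eq_iff Theta_def a_def weak_grad_def dx_def sum.distrib distrib_right)
  have Theta_v: "Theta \<Omega> F v x = (\<lambda>X. \<Sum>i\<in>UNIV. b x $ i * X $ i)" for x
    by (simp add: fun_eq_iff Theta_def b_def weak_grad_def dx_def sum.distrib distrib_right)
  have dTheta: "dTheta \<Omega> F x = (\<lambda>X Y. \<Sum>i\<in>UNIV. \<Sum>j\<in>UNIV. \<Phi> i j x * wedge11 (dx j) (dx i) X Y)" for x
    by (simp add: fun_eq_iff dTheta_def \<Phi>_def)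
  have nonint: "AE x in lborel. x \<in> \<Omega> \<longrightarrow> wedge12 (Theta \<Omega> F u x) (dTheta \<Omega> F x) \<noteq> (\<lambda>X Y Z. 0) \<or>
      wedge12 (Theta \<Omega> F v x) (dTheta \<Omega> F x) \<noteq> (\<lambda>X Y Z. 0)"
    using assms(11)
  proof
    assume "nonintegrable \<Omega> F u"
    then have "AE x in lborel. x \<in> \<Omega> \<longrightarrow> wedge12 (Theta \<Omega> F u x) (dTheta \<Omega> F x) \<noteq> (\<lambda>X Y Z. 0)"
      unfolding nonintegrable_def AE_lebesgue_on_iff[OF \<open>open \<Omega>\<close>] .
    then show ?thesis by eventually_elim blast
  next
    assume "nonintegrable \<Omega> F v"
    then have "AE x in lborel. x \<in> \<Omega> \<longrightarrow> wedge12 (Theta \<Omega> F v x) (dTheta \<Omega> F x) \<noteq> (\<lambda>X Y Z. 0)"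
      unfolding nonintegrable_def AE_lebesgue_on_iff[OF \<open>open \<Omega>\<close>] .
    then show ?thesis by eventually_elim blast
  qed
  have "AE x in lborel. x \<in> \<Omega> \<longrightarrow> weak_grad \<Omega> u x = weak_grad \<Omega> v x"
    using quotients[where w="\<lambda>i. weak_deriv \<Omega> [i] u" and w'=U, OF U(1)]
      quotients[where w="\<lambda>i. weak_deriv \<Omega> [i] v" and w'=V, OF V(1)]
      quotients[where w="\<lambda>i y. F y $ i" and w'=\<Phi>, OF \<Phi>] proportional proportional_shift nonint
  proof eventually_elim
    case (elim x)
    note quot_u = elim(1)[rule_format] and quot_v = elim(2)[rule_format] and quot_F = elim(3)[rule_format]
      and prop_x = elim(4)[rule_format] and prop_shift = elim(5)[rule_format] and wedge = elim(6)[rule_format]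
    show ?case
    proof
      assume x: "x \<in> \<Omega>"
      define \<gamma> where "\<gamma> = norm (b x) / norm (a x)"
      have b_x: "b x = \<gamma> *\<^sub>R a x" and "a x \<noteq> 0"
        using prop_x[OF x] by (auto simp: \<gamma>_def)
      have "(U i k x + \<Phi> i k x) * (\<gamma> * a x $ j) + a x $ i * (V j k x + \<Phi> j k x)
          = (U j k x + \<Phi> j k x) * (\<gamma> * a x $ i) + a x $ j * (V i k x + \<Phi> i k x)" for i j k
      proof -
        have quot_a: "(\<lambda>n. real (Suc n) * (a (shift k n x) $ i - a x $ i)) \<longlonglongrightarrow> U i k x + \<Phi> i k x" for i
          using tendsto_add[OF quot_u[OF x, of i k] quot_F[OF x, of k i]]
          by (simp add: a_def weak_grad_def algebra_simps)
        have quot_b: "(\<lambda>n. real (Suc n) * (b (shift k n x) $ i - b x $ i)) \<longlonglongrightarrow> V i k x + \<Phi> i k x" for i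
          using tendsto_add[OF quot_v[OF x, of i k] quot_F[OF x, of k i]]
          by (simp add: b_def weak_grad_def algebra_simps)
        have "(\<lambda>n. shift k n x) \<longlonglongrightarrow> x + 0 *\<^sub>R axis k 1"
          unfolding shift_def by (intro tendsto_intros LIMSEQ_inverse_real_of_nat)
        then have "\<forall>\<^sub>F n in sequentially. shift k n x \<in> \<Omega>"
          using topological_tendstoD[OF _ \<open>open \<Omega>\<close>] x by force
        then have "\<forall>\<^sub>F n in sequentially. a (shift k n x) $ i * b (shift k n x) $ j
            = a (shift k n x) $ j * b (shift k n x) $ i"
        proof eventually_elim
          case (elim n)
          from prop_shift[OF elim] obtain c where "b (shift k n x) = c *\<^sub>R a (shift k n x)" by blast
          then show ?case by simp
        qed
        moreover have "a x $ i * b x $ j = a x $ j * b x $ i"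
          by (simp add: b_x)
        ultimately have "(U i k x + \<Phi> i k x) * b x $ j + a x $ i * (V j k x + \<Phi> j k x)
          = (U j k x + \<Phi> j k x) * b x $ i + a x $ j * (V i k x + \<Phi> i k x)"
          by (rule product_rule_from_quotients[OF quot_a quot_b quot_a quot_b])
        then show ?thesis by (simp add: b_x)
      qed
      note eq_1 = proportionality_factor_eq_1[OF \<open>a x \<noteq> 0\<close> _ _ this]
      have Theta_v_x: "Theta \<Omega> F v x = (\<lambda>X. \<gamma> * (\<Sum>i\<in>UNIV. a x $ i * X $ i))"
        by (simp add: Theta_v b_x sum_distrib_left mult.assoc)
      have "\<gamma> = 1"
        using wedge[OF x]
      proof
        assume "wedge12 (Theta \<Omega> F u x) (dTheta \<Omega> F x) \<noteq> (\<lambda>X Y Z. 0)"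
        then show ?thesis
          unfolding Theta_u dTheta by (rule eq_1[OF fun_cong[OF U(2)] fun_cong[OF V(2)]])
      next
        assume "wedge12 (Theta \<Omega> F v x) (dTheta \<Omega> F x) \<noteq> (\<lambda>X Y Z. 0)"
        then show ?thesis
          unfolding Theta_v_x dTheta by (rule eq_1[OF fun_cong[OF U(2)] fun_cong[OF V(2)]])
      qed
      then show "weak_grad \<Omega> u x = weak_grad \<Omega> v x"
        using b_x by (simp add: a_def b_def)
    qed
  qed
  then show ?thesis
    by (simp add: AE_lebesgue_on_iff[OF \<open>open \<Omega>\<close>])
qed

end
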